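(* Let $\mathbb{F}$ be a finite field and let $\mathcal{C},\mathcal{C}'\subseteq\mathbb{F}((z))^n$ be two convolutional codes with the same overall constraint length and such that $\bar{\Lambda}(\mathcal{C})=\bar{\Lambda}(\mathcal{C}')$ (equality of generalized adjacency matrices). Then $\mathcal{C}$ and $\mathcal{C}'$ have the same dimension and, up to ordering, the same Forney indices.
   Context: Let $\mathbb{F}$ be a finite field with $q$ elements. **Codes.** A matrix $G\in\mathbb{F}[z]^{k\times n}$ is *basic* if it has a right inverse in $\mathbb{F}[z]^{n\times k}$. A *convolutional code* of dimension $k$ is a subspace $\mathcal{C}=\operatorname{im}G=\{uG\mid u\in\mathbb{F}((z))^k\}$ of $\mathbb{F}((z))^n$ with $G\in\mathbb{F}[z]^{k\times n}$ basic; such a $G$ is called a *generator matrix*. The *overall constraint length* of $\mathcal{C}$ is the maximal degree of the $k\times k$ minors of $G$; it depends only on $\mathcal{C}$. A generator matrix is *minimal* if the sum of its row degrees (the degree of a row being the maximal degree of its entries) equals the overall constraint length. Every code has a minimal generator matrix, and the row degrees of a minimal generator matrix are, up to ordering, uniquely determined by the code; they are called its *Forney indices*. **Controller canonical form.** Let $G=(g_{ij})\in\mathbb{F}[z]^{k\times n}$ be a minimal generator matrix with row degrees $\gamma_1,\dots,\gamma_k$, $\gamma=\sum_i\gamma_i$, and $g_{ij}=\sum_{\nu=0}^{\gamma_i}g_{ij}^{(\nu)}z^\nu$. For each $i$ let $A_i\in\mathbb{F}^{\gamma_i\times\gamma_i}$ have ones on the first superdiagonal and zeros elsewhere, $B_i=(1,0,\dots,0)\in\mathbb{F}^{1\times\gamma_i}$,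 and let $C_i\in\mathbb{F}^{\gamma_i\times n}$ have $\nu$-th row $(g_{i1}^{(\nu)},\dots,g_{in}^{(\nu)})$, $\nu=1,\dots,\gamma_i$. Put $A=\operatorname{diag}(A_1,\dots,A_k)\in\mathbb{F}^{\gamma\times\gamma}$, $B=\operatorname{diag}(B_1,\dots,B_k)\in\mathbb{F}^{k\times\gamma}$ (block diagonal), let $C\in\mathbb{F}^{\gamma\times n}$ be $C_1,\dots,C_k$ stacked, and $D=(g_{ij}^{(0)})\in\mathbb{F}^{k\times n}$. If $\gamma_i=0$, the corresponding blocks are missing and the $i$-th row of $B$ is zero. **Adjacency matrix.** Let $s=q^\gamma$ and order the state space $\mathbb{F}^\gamma=\{X_0,\dots,X_{s-1}\}$ (row vectors) with $X_0=0$. With $\operatorname{wt}$ the Hamming weight on $\mathbb{F}^n$, for $i,j\in\{0,\dots,s-1\}$ and $\alpha\in\{0,\dots,n\}$ put $\lambda_{i,j}^{(\alpha)}=\#\{u\in\mathbb{F}^k\mid X_j=X_iA+uB,\ \operatorname{wt}(X_iC+uD)=\alpha\}$, except that $\lambda_{0,0}^{(0)}:=0$. The adjacency matrix of $G$ is $\Lambda_G=\big(\sum_{\alpha=0}^n\lambda_{i,j}^{(\alpha)}W^\alpha\big)_{i,j=0,\dots,s-1}\in\mathbb{Q}[W]^{s\times s}$. If $\gamma=0$ (block code) the state space is $\{0\}$ and $\Lambda_G=\sum_{u\in\mathbb{F}^k\setminus\{0\}}W^{\operatorname{wt}(uD)}$ is a $1\times1$ matrix. **Generalized adjacency matrix.**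 Let $\mathcal{G}$ be the group of permutation matrices $\Pi\in GL_s(\mathbb{Q})$ with $\Pi_{0,0}=1$ (indices running from $0$ to $s-1$). For $\Lambda\in\mathbb{Q}[W]^{s\times s}$ put $\overline{\Lambda}=\{\Pi\Lambda\Pi^{-1}\mid\Pi\in\mathcal{G}\}$. The generalized adjacency matrix of $\mathcal{C}$ is $\bar{\Lambda}(\mathcal{C}):=\overline{\Lambda_G}$ for any minimal generator matrix $G$ of $\mathcal{C}$ and any ordering of states with $X_0=0$; it does not depend on these choices. *)

theory Defs
  imports
    "HOL-Computational_Algebra.Computational_Algebra"
    "HOL-Library.Cardinality"
    "Jordan_Normal_Form.Matrix"
    "Jordan_Normal_Form.Determinant"
    "Jordan_Normal_Form.DL_Submatrix"
begin

unbundle no fps_syntax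

text \<open>
  Vectors are row vectors throughout, so \<open>v M\<close> is rendered as \<open>M\<^sup>T *\<^sub>v v\<close>.
  The finite field is the type \<open>'a\<close>, its polynomial ring is \<open>'a poly\<close>, and \<open>'a fls\<close> is the
  field of formal Laurent series over \<open>'a\<close> (finitely many negative powers of \<open>z\<close>).
\<close>

definition vec_times_mat :: "'a::semiring_0 vec \<Rightarrow> 'a mat \<Rightarrow> 'a vec" (infixl \<open>\<^sub>v*\<close> 70)
  where "v \<^sub>v* M = transpose_mat M *\<^sub>v v"

definition hamming_weight :: "'a::zero vec \<Rightarrow> nat"
  where "hamming_weight v = card {i. i < dim_vec v \<and> v $ i \<noteq> 0}"


section \<open>Convolutional codes\<close>

definition basic_mat :: "'a::field poly mat \<Rightarrow> bool"
  where "basic_mat G \<longleftrightarrow>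
    (\<exists>H \<in> carrier_mat (dim_col G) (dim_row G). G * H = 1\<^sub>m (dim_row G))"

definition fls_of_poly :: "'a::field poly \<Rightarrow> 'a fls"
  where "fls_of_poly p = fps_to_fls (fps_of_poly p)"

definition code_of :: "'a::field poly mat \<Rightarrow> 'a fls vec set"
  where "code_of G = {u \<^sub>v* map_mat fls_of_poly G | u. u \<in> carrier_vec (dim_row G)}"

definition generator_matrix :: "nat \<Rightarrow> 'a::field fls vec set \<Rightarrow> 'a poly mat \<Rightarrow> bool"
  where "generator_matrix n \<C> G \<longleftrightarrow> dim_col G = n \<and> basic_mat G \<and> \<C> = code_of G"

definition convolutional_code :: "nat \<Rightarrow> nat \<Rightarrow> 'a::field fls vec set \<Rightarrow> bool"
  where "convolutional_code n k \<C> \<longleftrightarrow> (\<exists>G \<in> carrier_mat k n. generator_matrix n \<C> G)"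

text \<open>
  The full-size minors arise by selecting as many columns as there are rows. A zero minor
  has \<open>degree\<close> 0, which does not affect the maximum, since a basic matrix has a
  nonzero full-size minor. In the same way all rows of a basic matrix are nonzero.
\<close>

definition max_minor_degree :: "'a::field poly mat \<Rightarrow> nat"
  where "max_minor_degree G =
    Max {degree (det (submatrix G UNIV J)) | J. J \<subseteq> {..<dim_col G} \<and> card J = dim_row G}"

definition overall_constraint_length :: "nat \<Rightarrow> 'a::field fls vec set \<Rightarrow> nat"
  where "overall_constraint_length n \<C> =
    (THE d. \<exists>G. generator_matrix n \<C> G \<and> d = max_minor_degree G)"

definition row_degree :: "'a::zero poly mat \<Rightarrow> nat \<Rightarrow> nat"
  where "row_degree G i = Max {degree (G $$ (i, j)) | j. j < dim_col G}"

definition row_degrees :: "'a::zero poly mat \<Rightarrow> nat list"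
  where "row_degrees G = map (row_degree G) [0..<dim_row G]"

definition minimal_generator_matrix :: "nat \<Rightarrow> 'a::field fls vec set \<Rightarrow> 'a poly mat \<Rightarrow> bool"
  where "minimal_generator_matrix n \<C> G \<longleftrightarrow>
    generator_matrix n \<C> G \<and> sum_list (row_degrees G) = overall_constraint_length n \<C>"

definition forney_indices :: "nat \<Rightarrow> 'a::field fls vec set \<Rightarrow> nat multiset"
  where "forney_indices n \<C> =
    (THE M. \<exists>G. minimal_generator_matrix n \<C> G \<and> M = mset (row_degrees G))"


section \<open>Controller canonical form\<close>

text \<open>
  All indices start at 0. If row \<open>i\<close> of \<open>G\<close> has degree 0, then its blocks
  have sizes 0 x 0, 1 x 0 and 0 x n, so that \<open>diag_block_mat\<close> contributes a zero row to \<open>B\<close>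
  and nothing to \<open>A\<close>.
\<close>

definition ccf_A :: "'a::field poly mat \<Rightarrow> 'a mat"
  where "ccf_A G = diag_block_mat
    (map (\<lambda>d. mat d d (\<lambda>(i, j). if j = Suc i then 1 else 0)) (row_degrees G))"

definition ccf_B :: "'a::field poly mat \<Rightarrow> 'a mat"
  where "ccf_B G = diag_block_mat
    (map (\<lambda>d. mat 1 d (\<lambda>(i, j). if j = 0 then 1 else 0)) (row_degrees G))"

definition ccf_C_block :: "'a::field poly mat \<Rightarrow> nat \<Rightarrow> 'a mat"
  where "ccf_C_block G i =
    mat (row_degree G i) (dim_col G) (\<lambda>(\<nu>, j). coeff (G $$ (i, j)) (Suc \<nu>))"

definition ccf_C :: "'a::field poly mat \<Rightarrow> 'a mat"
  where "ccf_C G = foldr (@\<^sub>r) (map (ccf_C_block G) [0..<dim_row G]) (0\<^sub>m 0 (dim_col G))"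

definition ccf_D :: "'a::field poly mat \<Rightarrow> 'a mat"
  where "ccf_D G = map_mat (\<lambda>p. coeff p 0) G"


section \<open>Adjacency matrices\<close>

abbreviation state_dim :: "'a::field poly mat \<Rightarrow> nat"
  where "state_dim G \<equiv> sum_list (row_degrees G)"

definition state_ordering :: "'a::{field,finite} poly mat \<Rightarrow> (nat \<Rightarrow> 'a vec) \<Rightarrow> bool"
  where "state_ordering G X \<longleftrightarrow>
    bij_betw X {..<CARD('a) ^ state_dim G} (carrier_vec (state_dim G)) \<and>
    X 0 = 0\<^sub>v (state_dim G)"

definition transition_count ::
  "'a::{field,finite} poly mat \<Rightarrow> (nat \<Rightarrow> 'a vec) \<Rightarrow> nat \<Rightarrow> nat \<Rightarrow> nat \<Rightarrow> nat"
  where "transition_count G X i j \<alpha> =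
    (if i = 0 \<and> j = 0 \<and> \<alpha> = 0 then 0
     else card {u \<in> carrier_vec (dim_row G).
       X j = X i \<^sub>v* ccf_A G + u \<^sub>v* ccf_B G \<and>
       hamming_weight (X i \<^sub>v* ccf_C G + u \<^sub>v* ccf_D G) = \<alpha>})"

text \<open>
  For a block code (all row degrees 0) this is the 1 x 1 matrix whose entry is the sum of
  \<open>W ^ wt (u D)\<close> over all nonzero \<open>u\<close>: there \<open>D = G\<close> has a right inverse, so \<open>u = 0\<close> is the
  only message of weight 0, and it is discarded by the convention in \<open>transition_count\<close>.
\<close>

definition adjacency_matrix ::
  "'a::{field,finite} poly mat \<Rightarrow> (nat \<Rightarrow> 'a vec) \<Rightarrow> rat poly mat"
  where "adjacency_matrix G X =
    mat (CARD('a) ^ state_dim G) (CARD('a) ^ state_dim G)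
      (\<lambda>(i, j). \<Sum>\<alpha> = 0..dim_col G. monom (of_nat (transition_count G X i j \<alpha>)) \<alpha>)"

definition pointed_permutation_mats :: "nat \<Rightarrow> rat mat set"
  where "pointed_permutation_mats s =
    {P. (\<exists>\<pi>. \<pi> permutes {..<s} \<and> P = mat s s (\<lambda>(i, j). if j = \<pi> i then 1 else 0)) \<and>
        P $$ (0, 0) = 1}"

text \<open>
  \<open>similar_mat_wit M \<Lambda> P Q\<close> states that \<open>P\<close> and \<open>Q\<close> are mutually inverse and \<open>M = P * \<Lambda> * Q\<close>.
\<close>

definition permutation_class :: "rat poly mat \<Rightarrow> rat poly mat set"
  where "permutation_class \<Lambda> =
    {M. \<exists>P \<in> pointed_permutation_mats (dim_row \<Lambda>). \<exists>Q.
        similar_mat_wit M \<Lambda> (map_mat (\<lambda>c. [:c:]) P) Q}"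

text \<open>
  The class does not depend on the minimal generator matrix and the ordering of the states,
  hence an arbitrary choice.
\<close>

definition generalized_adjacency_matrix ::
  "nat \<Rightarrow> 'a::{field,finite} fls vec set \<Rightarrow> rat poly mat set"
  where "generalized_adjacency_matrix n \<C> =
    (SOME L. \<exists>G X. minimal_generator_matrix n \<C> G \<and> state_ordering G X \<and>
       L = permutation_class (adjacency_matrix G X))"

end

theory Submission
  imports Defs
begin

unbundle no fps_syntax

text \<open>
  Two quantities read off the adjacency matrix are invariant under renumbering the nonzero states.
  Evaluating row 0 at \<open>W = 1\<close> counts all inputs but the zero input, so it yields \<open>q\<^sup>k - 1\<close>. The states
  reachable from 0 in \<open>r\<close> steps are those whose \<open>i\<close>-th shift register is filled in its first
  \<open>min \<gamma>\<^sub>i r\<close> cells only, so there are \<open>q\<close> to the power \<open>\<Sum>\<^sub>i min \<gamma>\<^sub>i r\<close> of them; together with \<open>k\<close>, these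
  sums determine the multiset of the row degrees \<open>\<gamma>\<^sub>i\<close>.

  Since Forney indices and adjacency matrices are defined through arbitrary choices, minimal generator
  matrices must exist and have unique row degrees. Both facts rest on the equivalence of minimality
  with row reducedness (a leading row coefficient matrix with trivial left kernel).
\<close>

section \<open>Linear algebra\<close>

text \<open>A row of degree 0 owns no register cell, so it leaves no trace in the reachable sets.
  This is why \<open>k\<close> is read off separately. It can then be combined with those sets:
  \<open>(r - d) + min d r = r\<close> holds for truncated subtraction, so the sums of
  \<open>min d r\<close> and the number of rows give the sums of \<open>r - d\<close>. The latter
  are also the exponents in the count of polynomial codewords of degree below \<open>r\<close>, so
  one lemma on multisets settles both the uniqueness of the row degrees and the theorem. In the
  count of inputs, the convention at entry (0, 0) must discard one input and no more. Here it
  matters that a generator matrix is basic: an input that keeps state 0 and has output 0 is itself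
  0. Ranks over Laurent series are avoided: sizes of generator matrices are compared by setting
  \<open>z = 0\<close> and counting vectors over the finite field.\<close>

lemma dim_vec_times_mat [simp]: "dim_vec (v \<^sub>v* A) = dim_col A"
  by (simp add: vec_times_mat_def)

lemma vec_times_mat_carrier [simp, intro]:
  "A \<in> carrier_mat m n \<Longrightarrow> v \<^sub>v* A \<in> carrier_vec n"
  by (auto intro: carrier_vecI)

lemma vec_times_mat_index:
  fixes v :: "'a::comm_semiring_0 vec"
  assumes "v \<in> carrier_vec (dim_row A)" "j < dim_col A"
  shows "(v \<^sub>v* A) $ j = (\<Sum>i<dim_row A. v $ i * A $$ (i, j))"
  using assms
  by (auto simp: vec_times_mat_def scalar_prod_def mult.commute atLeast0LessThan intro!: sum.cong)

lemma vec_times_mat_assoc: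
  fixes v :: "'a::comm_ring_1 vec"
  assumes "v \<in> carrier_vec m" "A \<in> carrier_mat m n" "B \<in> carrier_mat n p"
  shows "v \<^sub>v* A \<^sub>v* B = v \<^sub>v* (A * B)"
  using assms
  by (simp add: vec_times_mat_def transpose_mult assoc_mult_mat_vec[where n\<^sub>2 = n and n\<^sub>3 = m])

lemma vec_times_mat_one [simp]:
  fixes v :: "'a::comm_ring_1 vec"
  assumes "v \<in> carrier_vec n"
  shows "v \<^sub>v* 1\<^sub>m n = v"
  using assms by (simp add: vec_times_mat_def)

lemma zero_vec_times_mat [simp]:
  fixes A :: "'a::comm_ring_1 mat"
  assumes "A \<in> carrier_mat m n"
  shows "0\<^sub>v m \<^sub>v* A = 0\<^sub>v n"
  using assms by (intro eq_vecI) (auto simp: vec_times_mat_index)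

lemma unit_vec_times_mat:
  fixes A :: "'a::comm_ring_1 mat"
  assumes "A \<in> carrier_mat m n" "i < m"
  shows "unit_vec m i \<^sub>v* A = row A i"
proof (rule eq_vecI)
  fix j assume "j < dim_vec (row A i)"
  then have j: "j < n" using assms by simp
  have "(unit_vec m i \<^sub>v* A) $ j = (\<Sum>l<m. unit_vec m i $ l * A $$ (l, j))"
    using assms j by (subst vec_times_mat_index) auto
  also have "\<dots> = (\<Sum>l<m. if l = i then A $$ (l, j) else 0)"
    using assms by (intro sum.cong) (auto simp: unit_vec_def)
  finally show "(unit_vec m i \<^sub>v* A) $ j = row A i $ j"
    using assms j by simp
qed (use assms in auto)

lemma row_mult_eq:
  fixes A :: "'a::comm_ring_1 mat"
  assumes "A \<in> carrier_mat m n" "B \<in> carrier_mat n p" "i < m"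
  shows "row (A * B) i = row A i \<^sub>v* B"
  using assms unit_vec_times_mat[of A m n i] unit_vec_times_mat[of "A * B" m p i]
    vec_times_mat_assoc[of "unit_vec m i" m A n B p]
  by simp

lemma eq_mat_by_rows:
  assumes "A \<in> carrier_mat m n" "B \<in> carrier_mat m n" "\<And>i. i < m \<Longrightarrow> row A i = row B i"
  shows "A = B"
  using assms by (metis carrier_matD(1) eq_rowI carrier_matD(2))

text \<open>Multiplication by \<open>B\<close> undoes multiplication by \<open>A\<close>. The
  setting of commutative rings covers both polynomial matrices and matrices over the field.\<close>

lemma right_invertible_imp_inj:
  fixes A :: "'a::comm_ring_1 mat"
  assumes "A \<in> carrier_mat m n" "B \<in> carrier_mat n m" "A * B = 1\<^sub>m m"
  shows "inj_on (\<lambda>v. v \<^sub>v* A) (carrier_vec m)"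
proof (rule inj_onI)
  fix u v assume uv: "u \<in> carrier_vec m" "v \<in> carrier_vec m" "u \<^sub>v* A = v \<^sub>v* A"
  have *: "w \<^sub>v* A \<^sub>v* B = w" if "w \<in> carrier_vec m" for w
    using vec_times_mat_assoc[OF that assms(1,2)] assms(3) that by simp
  have "u = u \<^sub>v* A \<^sub>v* B" using * uv(1) by simp
  also have "\<dots> = v \<^sub>v* A \<^sub>v* B" by (simp only: uv(3))
  also have "\<dots> = v" by (rule *[OF uv(2)])
  finally show "u = v" .
qed

section \<open>Counting vectors given coordinatewise\<close>

text \<open>Serves three counts: the whole space, messages with a degree bound on each coordinate,
  and the states of a partly filled register.\<close>

lemma card_vec_PiE:
  "card {v \<in> carrier_vec k. \<forall>i<k. v $ i \<in> A i} = (\<Prod>i<k. card (A i))"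
proof -
  have "bij_betw (vec k) (Pi\<^sub>E {..<k} A) {v \<in> carrier_vec k. \<forall>i<k. v $ i \<in> A i}"
  proof (rule bij_betwI')
    fix f g assume fg: "f \<in> Pi\<^sub>E {..<k} A" "g \<in> Pi\<^sub>E {..<k} A"
    show "(vec k f = vec k g) = (f = g)"
    proof
      assume "vec k f = vec k g"
      then have "f i = g i" if "i < k" for i using that by (metis index_vec)
      then show "f = g" using fg by (intro PiE_ext) auto
    qed simp
  next
    fix f assume "f \<in> Pi\<^sub>E {..<k} A"
    then show "vec k f \<in> {v \<in> carrier_vec k. \<forall>i<k. v $ i \<in> A i}" by auto
  next
    fix v assume v: "v \<in> {v \<in> carrier_vec k. \<forall>i<k. v $ i \<in> A i}"
    have "v = vec k (restrict (($) v) {..<k})" using v by (intro eq_vecI) auto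
    moreover have "restrict (($) v) {..<k} \<in> Pi\<^sub>E {..<k} A" using v by auto
    ultimately show "\<exists>f\<in>Pi\<^sub>E {..<k} A. v = vec k f" by blast
  qed
  then show ?thesis by (simp add: bij_betw_same_card[symmetric] card_PiE)
qed

lemma card_carrier_vec: "card (carrier_vec k :: 'a::finite vec set) = CARD('a) ^ k"
  using card_vec_PiE[of k "\<lambda>_. UNIV :: 'a set"] by simp

lemma finite_carrier_vec [simp]: "finite (carrier_vec k :: 'a::finite vec set)"
  by (rule card_ge_0_finite) (simp add: card_carrier_vec)

lemma CARD_field_gt_1: "CARD('a::{field,finite}) > 1"
proof -
  have "card {0, 1 :: 'a} \<le> CARD('a)" by (intro card_mono) auto
  then show ?thesis by simp
qed

section \<open>Full-size minors and left kernels\<close>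

lemma submatrix_UNIV_carrier:
  assumes "A \<in> carrier_mat k n" "J \<subseteq> {..<n}"
  shows "submatrix A UNIV J \<in> carrier_mat k (card J)"
proof -
  have "{j. j < n \<and> j \<in> J} = J" using assms(2) by auto
  then show ?thesis using assms by (auto simp: submatrix_def)
qed

lemma submatrix_UNIV_index:
  assumes "A \<in> carrier_mat k n" "J \<subseteq> {..<n}" "i < k" "j < card J"
  shows "submatrix A UNIV J $$ (i, j) = A $$ (i, pick J j)" "pick J j < n"
proof -
  have J: "{j. j < n \<and> j \<in> J} = J" using assms(2) by auto
  then show "submatrix A UNIV J $$ (i, j) = A $$ (i, pick J j)"
    using assms by (auto simp: submatrix_def pick_UNIV)
  show "pick J j < n" using assms J by (intro pick_le) simp
qed

text \<open>A column of a product depends only on the same column of the right factor. For square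
  \<open>A\<close> this makes every full-size minor of \<open>A * B\<close> equal to
  \<open>det A\<close> times that of \<open>B\<close>.\<close>

lemma submatrix_mult_UNIV:
  assumes "A \<in> carrier_mat m k" "B \<in> carrier_mat k n" "J \<subseteq> {..<n}"
  shows "submatrix (A * B) UNIV J = A * submatrix B UNIV J"
proof (rule eq_matI)
  have sB: "submatrix B UNIV J \<in> carrier_mat k (card J)"
    by (rule submatrix_UNIV_carrier[OF assms(2,3)])
  have sAB: "submatrix (A * B) UNIV J \<in> carrier_mat m (card J)"
    by (rule submatrix_UNIV_carrier[of _ m n]) (use assms in auto)
  show "dim_row (submatrix (A * B) UNIV J) = dim_row (A * submatrix B UNIV J)"
    "dim_col (submatrix (A * B) UNIV J) = dim_col (A * submatrix B UNIV J)"
    using sB sAB assms by auto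
  fix i j assume "i < dim_row (A * submatrix B UNIV J)" "j < dim_col (A * submatrix B UNIV J)"
  then have ij: "i < m" "j < card J" using sB assms by auto
  have "submatrix (A * B) UNIV J $$ (i, j) = (A * B) $$ (i, pick J j)"
    by (rule submatrix_UNIV_index) (use assms ij in auto)
  also have "\<dots> = (A * submatrix B UNIV J) $$ (i, j)"
  proof -
    have "pick J j < n"
      by (rule submatrix_UNIV_index(2)[of "A * B" m n]) (use assms ij in auto)
    then show ?thesis
      using assms ij sB submatrix_UNIV_index[OF assms(2,3) _ ij(2)]
      by (auto simp: scalar_prod_def intro!: sum.cong)
  qed
  finally show "submatrix (A * B) UNIV J $$ (i, j) = (A * submatrix B UNIV J) $$ (i, j)" .
qed

lemma pick_strict_mono_image:
  assumes "strict_mono_on {..<k} f" "i < k"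
  shows "pick (f ` {..<k}) i = f i"
proof -
  have "{a \<in> f ` {..<k}. a < f i} = f ` {..<i}"
    using assms(2) by (auto simp: strict_mono_on_less[OF assms(1)])
  moreover have "inj_on f {..<i}"
    by (rule inj_on_subset[OF strict_mono_on_imp_inj_on[OF assms(1)]]) (use assms(2) in auto)
  ultimately have "card {a \<in> f ` {..<k}. a < f i} = i" by (simp add: card_image)
  moreover have "pick (f ` {..<k}) (card {a \<in> f ` {..<k}. a < f i}) = f i"
    by (rule pick_card_in_set) (use assms(2) in auto)
  ultimately show ?thesis by (simp only:)
qed

text \<open>In the reduced echelon form \<open>C = P * L\<close> every row has a pivot, and the
  pivot columns of \<open>C\<close> form the identity. Since \<open>P\<close> acts on columns
  simultaneously, the same columns of \<open>L\<close> form an invertible matrix.\<close>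

lemma nonzero_minor_if_trivial_left_kernel:
  fixes L :: "'a::field mat"
  assumes L: "L \<in> carrier_mat k n"
    and ker: "\<And>u. u \<in> carrier_vec k \<Longrightarrow> u \<^sub>v* L = 0\<^sub>v n \<Longrightarrow> u = 0\<^sub>v k"
  obtains J where "J \<subseteq> {..<n}" "card J = k" "det (submatrix L UNIV J) \<noteq> 0"
proof -
  define C where "C = gauss_jordan_single L"
  note gj = gauss_jordan_single[OF L C_def[symmetric]]
  have C: "C \<in> carrier_mat k n" by (rule gj(2))
  obtain P Q where PQ: "P \<in> carrier_mat k k" "Q \<in> carrier_mat k k"
      "C = P * L" "P * Q = 1\<^sub>m k"
    using gj(4) by metis
  obtain f where f: "pivot_fun C f n"
    using gj(3) C unfolding row_echelon_form_def by auto
  have dC: "dim_row C = k" using C by simp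
  note piv = pivot_funD[OF _ f, of k]
  \<comment> \<open>The pivot function has value \<open>n\<close> on a zero row. Such a row of
    \<open>C\<close> would put a row of \<open>P\<close> into the left kernel of \<open>L\<close>;
    that row of \<open>P\<close> would be zero, against the invertibility of
    \<open>P\<close>.\<close>
  have lt: "f i < n" if i: "i < k" for i
  proof (rule ccontr)
    assume "\<not> f i < n"
    then have "f i = n" using piv(1)[OF dC i] by simp
    have "row P i \<^sub>v* L = row C i"
      using row_mult_eq[OF PQ(1) L i] PQ(3) by simp
    also have "\<dots> = 0\<^sub>v n"
      using C i piv(2)[OF dC i] \<open>f i = n\<close> by (intro eq_vecI) auto
    finally have z: "row P i = 0\<^sub>v k" using ker PQ(1) i by auto
    have "row (1\<^sub>m k) i = row P i \<^sub>v* Q"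
      using row_mult_eq[OF PQ(1,2) i] PQ(4) by simp
    then have "(row (1\<^sub>m k) i :: 'a vec) = 0\<^sub>v k" using z PQ(2) by simp
    then have "(unit_vec k i :: 'a vec) $ i = 0\<^sub>v k $ i" using i by simp
    then show False using i by simp
  qed
  have step: "f i < f (Suc i)" if "Suc i < k" for i
    using piv(3)[OF dC, of i] that lt[of "Suc i"] by auto
  have mono: "strict_mono_on {..<k} f"
  proof (rule strict_mono_onI)
    fix i j assume ij: "i \<in> {..<k}" "j \<in> {..<k}" "i < j"
    then show "f i < f j"
    proof (induction j)
      case (Suc j)
      then show ?case using step[of j] by (cases "i = j") auto
    qed simp
  qed
  define J where "J = f ` {..<k}"
  have J: "J \<subseteq> {..<n}" using lt by (auto simp: J_def)
  have cJ: "card J = k"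
    unfolding J_def using strict_mono_on_imp_inj_on[OF mono] by (simp add: card_image)
  have "submatrix C UNIV J = 1\<^sub>m k"
  proof (rule eq_matI)
    fix i j assume "i < dim_row (1\<^sub>m k :: 'a mat)" "j < dim_col (1\<^sub>m k :: 'a mat)"
    then have ij: "i < k" "j < k" by auto
    have "submatrix C UNIV J $$ (i, j) = C $$ (i, pick J j)"
      using ij cJ by (intro submatrix_UNIV_index[OF C J]) auto
    also have "pick J j = f j" unfolding J_def by (rule pick_strict_mono_image[OF mono ij(2)])
    also have "C $$ (i, f j) = 1\<^sub>m k $$ (i, j)"
      using ij lt[of j] piv(4)[OF dC ij(2)] piv(5)[OF dC ij(2) _ ij(1)] by (cases "i = j") simp_all
    finally show "submatrix C UNIV J $$ (i, j) = 1\<^sub>m k $$ (i, j)" .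
  qed (use submatrix_UNIV_carrier[OF C J] cJ in auto)
  then have "P * submatrix L UNIV J = 1\<^sub>m k"
    using submatrix_mult_UNIV[OF PQ(1) L J] PQ(3) by simp
  then have "det P * det (submatrix L UNIV J) = 1"
    using det_mult[OF PQ(1), of "submatrix L UNIV J"] submatrix_UNIV_carrier[OF L J] cJ by simp
  then have "det (submatrix L UNIV J) \<noteq> 0" by auto
  then show ?thesis using that J cJ by blast
qed

lemma det_zero_if_left_kernel:
  fixes A :: "'a::field mat"
  assumes A: "A \<in> carrier_mat k k" and "u \<in> carrier_vec k" "u \<noteq> 0\<^sub>v k" "u \<^sub>v* A = 0\<^sub>v k"
  shows "det A = 0"
proof -
  have "det A\<^sup>T = 0"
    using assms by (subst det_0_iff_vec_prod_zero[of _ k]) (auto simp: vec_times_mat_def)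
  then show ?thesis using det_transpose[OF A] by simp
qed

section \<open>Generator matrices\<close>

text \<open>Codes live over Laurent series, generator matrices over polynomials. Injectivity allows
  identities between codewords to be pulled back to polynomials.\<close>

interpretation fls_of_poly: inj_comm_ring_hom "fls_of_poly :: 'a::field poly \<Rightarrow> 'a fls"
proof
  show "fls_of_poly (p + q) = fls_of_poly p + fls_of_poly q" for p q :: "'a poly"
    by (simp add: fls_of_poly_def fps_of_poly_add)
  show "fls_of_poly (p * q) = fls_of_poly p * fls_of_poly q" for p q :: "'a poly"
    by (simp add: fls_of_poly_def fps_of_poly_mult fls_times_fps_to_fls)
  show "fls_of_poly p = 0 \<Longrightarrow> p = 0" for p :: "'a poly"
    by (simp add: fls_of_poly_def)
qed (simp_all add: fls_of_poly_def)

lemma map_vec_times_mat: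
  fixes A :: "'a::field poly mat"
  assumes "v \<in> carrier_vec (dim_row A)"
  shows "map_vec fls_of_poly (v \<^sub>v* A) = map_vec fls_of_poly v \<^sub>v* map_mat fls_of_poly A"
  using assms
  by (intro eq_vecI) (auto simp: vec_times_mat_index fls_of_poly.hom_sum fls_of_poly.hom_mult)

text \<open>The right inverse recovers the message of a codeword as \<open>w\<close> times
  \<open>H\<close>, so a polynomial codeword has a polynomial message. Membership in the code
  thereby becomes an identity over polynomials.\<close>

lemma polynomial_codewords:
  fixes G :: "'a::field poly mat"
  assumes G: "G \<in> carrier_mat k n" and H: "H \<in> carrier_mat n k" "G * H = 1\<^sub>m k"
    and w: "w \<in> carrier_vec n"
  shows "map_vec fls_of_poly w \<in> code_of G \<longleftrightarrow> w = w \<^sub>v* H \<^sub>v* G"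
proof
  assume "map_vec fls_of_poly w \<in> code_of G"
  then obtain u where u: "u \<in> carrier_vec k" "map_vec fls_of_poly w = u \<^sub>v* map_mat fls_of_poly G"
    using G by (auto simp: code_of_def)
  have "map_vec fls_of_poly (w \<^sub>v* H) = u \<^sub>v* map_mat fls_of_poly G \<^sub>v* map_mat fls_of_poly H"
    using map_vec_times_mat[of w H] w H u by simp
  also have "\<dots> = u \<^sub>v* map_mat fls_of_poly (G * H)"
    using vec_times_mat_assoc[of u k "map_mat fls_of_poly G" n "map_mat fls_of_poly H" k] u G H
      fls_of_poly.mat_hom_mult[OF G H(1)] by simp
  also have "\<dots> = u" using u H by (simp add: fls_of_poly.mat_hom_one)
  finally have "map_vec fls_of_poly w = map_vec fls_of_poly (w \<^sub>v* H) \<^sub>v* map_mat fls_of_poly G"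
    using u by simp
  also have "\<dots> = map_vec fls_of_poly (w \<^sub>v* H \<^sub>v* G)"
    using H G by (intro map_vec_times_mat[symmetric]) auto
  finally show "w = w \<^sub>v* H \<^sub>v* G"
    by (rule fls_of_poly.vec_hom_inj)
next
  assume w': "w = w \<^sub>v* H \<^sub>v* G"
  have "map_vec fls_of_poly w = map_vec fls_of_poly (w \<^sub>v* H \<^sub>v* G)"
    by (rule arg_cong[where f = "map_vec fls_of_poly", OF w'])
  also have "\<dots> = map_vec fls_of_poly (w \<^sub>v* H) \<^sub>v* map_mat fls_of_poly G"
    using H G by (intro map_vec_times_mat) auto
  finally have "map_vec fls_of_poly w = map_vec fls_of_poly (w \<^sub>v* H) \<^sub>v* map_mat fls_of_poly G" .
  moreover have "map_vec fls_of_poly (w \<^sub>v* H) \<in> carrier_vec (dim_row G)"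
    using G H by auto
  ultimately show "map_vec fls_of_poly w \<in> code_of G"
    unfolding code_of_def by blast
qed

lemma row_in_code_of:
  fixes G :: "'a::field poly mat"
  assumes "G \<in> carrier_mat k n" "i < k"
  shows "map_vec fls_of_poly (row G i) \<in> code_of G"
proof -
  have "map_vec fls_of_poly (row G i) = unit_vec k i \<^sub>v* map_mat fls_of_poly G"
    using assms by (subst unit_vec_times_mat[of _ k n]) auto
  then show ?thesis using assms by (auto simp: code_of_def)
qed

text \<open>Every row of \<open>G'\<close> is a polynomial codeword of \<open>G\<close>, and its
  message is the corresponding row of \<open>G' * H\<close>.\<close>

lemma code_of_subset_imp_factor:
  fixes G G' :: "'a::field poly mat"
  assumes "code_of G' \<subseteq> code_of G"
    and G: "G \<in> carrier_mat k n" and H: "H \<in> carrier_mat n k" "G * H = 1\<^sub>m k"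
    and G': "G' \<in> carrier_mat k' n"
  shows "G' = G' * H * G"
proof (rule eq_mat_by_rows[OF G'])
  show "G' * H * G \<in> carrier_mat k' n" using G G' H by simp
  fix i assume i: "i < k'"
  have "row G' i = row G' i \<^sub>v* H \<^sub>v* G"
    using row_in_code_of[OF G' i] assms(1) polynomial_codewords[OF G H, of "row G' i"] G' i
    by auto
  also have "\<dots> = row (G' * H * G) i"
    using row_mult_eq[OF G' H(1) i] row_mult_eq[of "G' * H" k' k G n i] G G' H i by simp
  finally show "row G' i = row (G' * H * G) i" .
qed

lemma code_of_mult_subset:
  fixes G :: "'a::field poly mat"
  assumes "U \<in> carrier_mat k' k" "G \<in> carrier_mat k n"
  shows "code_of (U * G) \<subseteq> code_of G"
proof
  fix c assume "c \<in> code_of (U * G)"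
  then obtain u where u: "u \<in> carrier_vec k'" "c = u \<^sub>v* map_mat fls_of_poly (U * G)"
    using assms by (auto simp: code_of_def)
  then have "c = u \<^sub>v* map_mat fls_of_poly U \<^sub>v* map_mat fls_of_poly G"
    using vec_times_mat_assoc[of u k' "map_mat fls_of_poly U" k "map_mat fls_of_poly G" n] assms
      fls_of_poly.mat_hom_mult[OF assms] by simp
  moreover have "u \<^sub>v* map_mat fls_of_poly U \<in> carrier_vec (dim_row G)" using assms by auto
  ultimately show "c \<in> code_of G" by (auto simp: code_of_def)
qed

lemma generator_matrixE:
  assumes "generator_matrix n \<C> G"
  obtains H where "G \<in> carrier_mat (dim_row G) n" "H \<in> carrier_mat n (dim_row G)"
    "G * H = 1\<^sub>m (dim_row G)" "\<C> = code_of G"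
proof -
  from assms obtain H where "H \<in> carrier_mat (dim_col G) (dim_row G)" "G * H = 1\<^sub>m (dim_row G)"
    and "dim_col G = n" "\<C> = code_of G"
    unfolding generator_matrix_def basic_mat_def by blast
  then show ?thesis by (intro that[of H] carrier_matI) simp_all
qed

lemma generator_matrixI:
  assumes "G \<in> carrier_mat k n" "H \<in> carrier_mat n k" "G * H = 1\<^sub>m k" "\<C> = code_of G"
  shows "generator_matrix n \<C> G"
  using assms by (auto simp: generator_matrix_def basic_mat_def)

text \<open>Invertible row operations keep the row space, and \<open>H * V\<close> is a right
  inverse of \<open>U * G\<close>.\<close>

lemma generator_matrix_unimodular:
  fixes G :: "'a::field poly mat"
  assumes "generator_matrix n \<C> G" "G \<in> carrier_mat k n"
    and U: "U \<in> carrier_mat k k" and V: "V \<in> carrier_mat k k" "U * V = 1\<^sub>m k" "V * U = 1\<^sub>m k"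
  shows "generator_matrix n \<C> (U * G)"
proof -
  from assms obtain H where G: "G \<in> carrier_mat k n" and H: "H \<in> carrier_mat n k" "G * H = 1\<^sub>m k"
    and C: "\<C> = code_of G"
    by (metis carrier_matD(1) generator_matrixE)
  have "U * G * (H * V) = U * (G * (H * V))"
    using G H(1) U V(1) by (intro assoc_mult_mat) auto
  also have "G * (H * V) = G * H * V"
    using G H(1) V(1) by (intro assoc_mult_mat[symmetric]) auto
  finally have "U * G * (H * V) = 1\<^sub>m k" using H(2) V(1,2) by simp
  moreover have "code_of G = code_of (U * G)"
  proof
    have "V * (U * G) = V * U * G"
      using assoc_mult_mat[OF V(1) U G] by simp
    then have "V * (U * G) = G" using V G by simp
    then show "code_of G \<subseteq> code_of (U * G)"
      using code_of_mult_subset[of V k k "U * G" n] U V G by simp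
  qed (rule code_of_mult_subset[OF U G])
  ultimately show ?thesis
    using C G H U V by (intro generator_matrixI[of _ k _ "H * V"]) auto
qed

text \<open>Setting \<open>z = 0\<close> preserves the identity \<open>M * N = 1\<close>, which
  leaves an injection between finite vector spaces; comparing cardinalities gives the bound.\<close>

lemma right_inverse_imp_dim_le:
  fixes M :: "'a::{field,finite} poly mat"
  assumes M: "M \<in> carrier_mat m k" and N: "N \<in> carrier_mat k m" and MN: "M * N = 1\<^sub>m m"
  shows "m \<le> k"
proof -
  let ?f = "\<lambda>p :: 'a poly. coeff p 0"
  interpret comm_ring_hom ?f by unfold_locales (simp_all add: coeff_mult_0)
  have "map_mat ?f M * map_mat ?f N = 1\<^sub>m m"
    using mat_hom_mult[OF M N] MN by (simp add: mat_hom_one)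
  then have "inj_on (\<lambda>v. v \<^sub>v* map_mat ?f M) (carrier_vec m)"
    using M N by (intro right_invertible_imp_inj[of _ m k "map_mat ?f N"]) auto
  moreover have "(\<lambda>v. v \<^sub>v* map_mat ?f M) ` carrier_vec m \<subseteq> carrier_vec k"
    using M by auto
  ultimately have "card (carrier_vec m :: 'a vec set) \<le> card (carrier_vec k :: 'a vec set)"
    by (intro card_inj_on_le) auto
  then show ?thesis using CARD_field_gt_1[where 'a = 'a] by (simp add: card_carrier_vec)
qed

text \<open>Each matrix factors through the other, and the right inverses show that the two factors
  are inverse to each other.\<close>

lemma generator_matrices_equivalent:
  fixes G G' :: "'a::{field,finite} poly mat"
  assumes "generator_matrix n \<C> G" "generator_matrix n \<C> G'"
  obtains U where "dim_row G' = dim_row G" "U \<in> carrier_mat (dim_row G) (dim_row G)"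
    "det U dvd 1" "G' = U * G"
proof -
  define k k' where "k = dim_row G" and "k' = dim_row G'"
  obtain H where G: "G \<in> carrier_mat k n" and H: "H \<in> carrier_mat n k" "G * H = 1\<^sub>m k"
    and C: "\<C> = code_of G"
    by (rule generator_matrixE[OF assms(1), folded k_def])
  obtain H' where G': "G' \<in> carrier_mat k' n" and H': "H' \<in> carrier_mat n k'" "G' * H' = 1\<^sub>m k'"
    and C': "\<C> = code_of G'"
    by (rule generator_matrixE[OF assms(2), folded k'_def])
  define U V where "U = G' * H" and "V = G * H'"
  have U: "U \<in> carrier_mat k' k" and V: "V \<in> carrier_mat k k'"
    unfolding U_def V_def using G H G' H' by auto
  have f: "G' = U * G" unfolding U_def
    by (rule code_of_subset_imp_factor[OF _ G H G']) (use C C' in auto)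
  have f': "G = V * G'" unfolding V_def
    by (rule code_of_subset_imp_factor[OF _ G' H' G]) (use C C' in auto)
  have "U * V = U * G * H'" unfolding V_def by (rule assoc_mult_mat[OF U G H'(1), symmetric])
  then have UV: "U * V = 1\<^sub>m k'" by (simp only: f[symmetric] H'(2))
  have "V * U = V * G' * H" unfolding U_def by (rule assoc_mult_mat[OF V G' H(1), symmetric])
  then have VU: "V * U = 1\<^sub>m k" by (simp only: f'[symmetric] H(2))
  \<comment> \<open>Up to here \<open>U\<close> and \<open>V\<close> may be rectangular; only their
    being square gives meaning to the product of determinants below.\<close>
  have kk: "k' = k"
    using right_inverse_imp_dim_le[OF U V UV] right_inverse_imp_dim_le[OF V U VU] by simp
  have "det U * det V = 1"
    using det_mult[of U k V] U V UV kk by simp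
  then have "det U dvd 1" by (metis dvdI)
  moreover have "U \<in> carrier_mat k k" using U kk by simp
  ultimately show ?thesis using that[of U] f kk unfolding k_def k'_def by blast
qed

text \<open>All full-size minors change by the common factor \<open>det U\<close>, a nonzero
  constant. A zero minor stays zero and counts as degree 0 on both sides.\<close>

lemma max_minor_degree_unique:
  fixes G G' :: "'a::{field,finite} poly mat"
  assumes "generator_matrix n \<C> G" "generator_matrix n \<C> G'"
  shows "max_minor_degree G = max_minor_degree G'"
proof -
  obtain U where U: "dim_row G' = dim_row G" "U \<in> carrier_mat (dim_row G) (dim_row G)"
    "det U dvd 1" "G' = U * G"
    by (rule generator_matrices_equivalent[OF assms])
  have n: "dim_col G = n" "dim_col G' = n" using assms by (auto simp: generator_matrix_def)
  have "degree (det (submatrix G' UNIV J)) = degree (det (submatrix G UNIV J))"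
    if J: "J \<subseteq> {..<n}" "card J = dim_row G" for J
  proof -
    have G: "G \<in> carrier_mat (dim_row G) n" using n by auto
    have "submatrix G' UNIV J = U * submatrix G UNIV J"
      unfolding U(4) by (rule submatrix_mult_UNIV[OF U(2) G J(1)])
    then have "det (submatrix G' UNIV J) = det U * det (submatrix G UNIV J)"
      using det_mult[OF U(2)] submatrix_UNIV_carrier[OF G J(1)] J(2) by simp
    moreover have "degree (det U) = 0" "det U \<noteq> 0"
      using U(3) by (auto simp: is_unit_poly_iff)
    ultimately show ?thesis
      by (cases "det (submatrix G UNIV J) = 0") (simp_all add: degree_mult_eq)
  qed
  then have "{degree (det (submatrix G UNIV J)) | J. J \<subseteq> {..<n} \<and> card J = dim_row G} =
    {degree (det (submatrix G' UNIV J)) | J. J \<subseteq> {..<n} \<and> card J = dim_row G}"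
    by (intro Collect_cong ex_cong1) auto
  then show ?thesis unfolding max_minor_degree_def n U(1) by (rule arg_cong)
qed

lemma overall_constraint_length_eq:
  fixes G :: "'a::{field,finite} poly mat"
  assumes "generator_matrix n \<C> G"
  shows "overall_constraint_length n \<C> = max_minor_degree G"
  unfolding overall_constraint_length_def
proof (rule the_equality)
  show "\<exists>G'. generator_matrix n \<C> G' \<and> max_minor_degree G = max_minor_degree G'"
    using assms by blast
  show "d = max_minor_degree G" if "\<exists>G. generator_matrix n \<C> G \<and> d = max_minor_degree G" for d
    using that max_minor_degree_unique[OF _ assms] by blast
qed

section \<open>Row degrees and minimality\<close>

lemma degree_le_row_degree:
  "j < dim_col G \<Longrightarrow> degree (G $$ (i, j)) \<le> row_degree G i"
  unfolding row_degree_def by (rule Max_ge) auto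

lemma row_degree_less:
  assumes "dim_col G > 0" "\<And>j. j < dim_col G \<Longrightarrow> degree (G $$ (i, j)) < d"
  shows "row_degree G i < d"
proof -
  have "degree (G $$ (i, 0)) \<in> {degree (G $$ (i, j)) | j. j < dim_col G}"
    using assms(1) by blast
  then show ?thesis unfolding row_degree_def using assms(2) by (subst Max_less_iff) auto
qed

lemma state_dim_eq_sum: "state_dim G = (\<Sum>i<dim_row G. row_degree G i)"
  by (simp add: row_degrees_def interv_sum_list_conv_sum_set_nat atLeast0LessThan)

section \<open>Leading row coefficients and the degrees of minors\<close>

text \<open>Coefficients are taken at the degree of the row, so an entry of smaller degree
  contributes 0.\<close>

definition lead_row_mat :: "'a::zero poly mat \<Rightarrow> 'a mat"
  where "lead_row_mat G =
    mat (dim_row G) (dim_col G) (\<lambda>(i, j). coeff (G $$ (i, j)) (row_degree G i))"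

lemma lead_row_mat_carrier [simp]:
  "G \<in> carrier_mat k n \<Longrightarrow> lead_row_mat G \<in> carrier_mat k n"
  by (simp add: lead_row_mat_def)

text \<open>The numbers \<open>g i\<close> are formal degrees, mere upper bounds. Leading
  coefficients at formal degrees multiply even if some of them vanish.\<close>

lemma degree_prod_le_and_coeff:
  fixes f :: "'i \<Rightarrow> 'a::comm_ring_1 poly"
  assumes "finite I" "\<And>i. i \<in> I \<Longrightarrow> degree (f i) \<le> g i"
  shows "degree (prod f I) \<le> sum g I \<and> coeff (prod f I) (sum g I) = (\<Prod>i\<in>I. coeff (f i) (g i))"
  using assms
proof (induction I rule: finite_induct)
  case (insert i I)
  have IH: "degree (prod f I) \<le> sum g I"
    "coeff (prod f I) (sum g I) = (\<Prod>i\<in>I. coeff (f i) (g i))" and d: "degree (f i) \<le> g i"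
    using insert by auto
  have "coeff (f i * prod f I) (g i + sum g I) =
      (\<Sum>s\<le>g i + sum g I. coeff (f i) s * coeff (prod f I) (g i + sum g I - s))"
    by (rule coeff_mult)
  \<comment> \<open>For \<open>s < g i\<close> the second factor is taken beyond its degree bound,
    for \<open>s > g i\<close> the first one is.\<close>
  also have "\<dots> = (\<Sum>s\<in>{g i}. coeff (f i) s * coeff (prod f I) (g i + sum g I - s))"
  proof (rule sum.mono_neutral_right)
    show "\<forall>s\<in>{..g i + sum g I} - {g i}. coeff (f i) s * coeff (prod f I) (g i + sum g I - s) = 0"
    proof
      fix s assume s: "s \<in> {..g i + sum g I} - {g i}"
      show "coeff (f i) s * coeff (prod f I) (g i + sum g I - s) = 0"
      proof (cases "s < g i")
        case True
        then show ?thesis using IH(1) by (simp add: coeff_eq_0)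
      next
        case False
        then show ?thesis using s d by (simp add: coeff_eq_0)
      qed
    qed
  qed auto
  finally have "coeff (f i * prod f I) (g i + sum g I) = (\<Prod>i\<in>insert i I. coeff (f i) (g i))"
    using insert.hyps IH(2) by simp
  moreover have "degree (f i * prod f I) \<le> g i + sum g I"
    using degree_mult_le[of "f i" "prod f I"] IH(1) d by simp
  ultimately show ?case using insert.hyps by simp
qed simp

text \<open>Each Leibniz term takes one factor from every row, so the row bounds add up, and its
  coefficient at their sum is the Leibniz term of the coefficient matrix.\<close>

lemma degree_det_le_and_coeff:
  fixes N :: "'a::comm_ring_1 poly mat"
  assumes N: "N \<in> carrier_mat k k"
    and d: "\<And>i j. i < k \<Longrightarrow> j < k \<Longrightarrow> degree (N $$ (i, j)) \<le> g i"
  shows "degree (det N) \<le> (\<Sum>i<k. g i)"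
    and "coeff (det N) (\<Sum>i<k. g i) = det (mat k k (\<lambda>(i, j). coeff (N $$ (i, j)) (g i)))"
proof -
  have p: "degree (\<Prod>i = 0..<k. N $$ (i, p i)) \<le> (\<Sum>i<k. g i) \<and>
      coeff (\<Prod>i = 0..<k. N $$ (i, p i)) (\<Sum>i<k. g i) = (\<Prod>i = 0..<k. coeff (N $$ (i, p i)) (g i))"
    if "p permutes {0..<k}" for p
    using degree_prod_le_and_coeff[of "{0..<k}" "\<lambda>i. N $$ (i, p i)" g] d permutes_in_image[OF that]
    by (simp add: atLeast0LessThan)
  have sgn: "degree (signof p * q) \<le> degree q" "coeff (signof p * q) m = signof p * coeff q m"
    for p :: "nat \<Rightarrow> nat" and q :: "'a poly" and m
    by (simp_all add: sign_def)
  have "degree (signof p * (\<Prod>i = 0..<k. N $$ (i, p i))) \<le> (\<Sum>i<k. g i)"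
    if "p permutes {0..<k}" for p
    using p[OF that] sgn(1) order_trans by blast
  then show "degree (det N) \<le> (\<Sum>i<k. g i)"
    unfolding det_def'[OF N] by (intro degree_sum_le) (auto simp: finite_permutations)
  have "coeff (det N) (\<Sum>i<k. g i) =
      (\<Sum>p\<in>{p. p permutes {0..<k}}. signof p * (\<Prod>i = 0..<k. coeff (N $$ (i, p i)) (g i)))"
    unfolding det_def'[OF N] coeff_sum using p by (intro sum.cong) (auto simp: sgn)
  also have "\<dots> = det (mat k k (\<lambda>(i, j). coeff (N $$ (i, j)) (g i)))"
  proof (subst det_def')
    show "(\<Sum>p | p permutes {0..<k}. signof p * (\<Prod>i = 0..<k. coeff (N $$ (i, p i)) (g i))) =
      (\<Sum>p | p permutes {0..<k}. signof p *
        (\<Prod>i = 0..<k. mat k k (\<lambda>(i, j). coeff (N $$ (i, j)) (g i)) $$ (i, p i)))"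
      using permutes_in_image by (fastforce intro!: sum.cong prod.cong)
  qed simp
  finally show "coeff (det N) (\<Sum>i<k. g i) = det (mat k k (\<lambda>(i, j). coeff (N $$ (i, j)) (g i)))" .
qed

lemma minor_degree_le_and_coeff:
  fixes G :: "'a::field poly mat"
  assumes G: "G \<in> carrier_mat k n" and J: "J \<subseteq> {..<n}" "card J = k"
  shows "degree (det (submatrix G UNIV J)) \<le> state_dim G"
    and "coeff (det (submatrix G UNIV J)) (state_dim G) = det (submatrix (lead_row_mat G) UNIV J)"
proof -
  have s: "submatrix G UNIV J \<in> carrier_mat k k"
    using submatrix_UNIV_carrier[OF G J(1)] J(2) by simp
  have p: "submatrix G UNIV J $$ (i, j) = G $$ (i, pick J j)" "pick J j < n" if "i < k" "j < k" for i j
    using submatrix_UNIV_index[OF G J(1) that(1), of j] that J by auto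
  have d: "degree (submatrix G UNIV J $$ (i, j)) \<le> row_degree G i" if "i < k" "j < k" for i j
    using degree_le_row_degree[of "pick J j" G i] p[OF that] G by simp
  have sd: "state_dim G = (\<Sum>i<k. row_degree G i)" using G by (simp add: state_dim_eq_sum)
  show "degree (det (submatrix G UNIV J)) \<le> state_dim G"
    unfolding sd by (rule degree_det_le_and_coeff(1)[OF s d])
  have "mat k k (\<lambda>(i, j). coeff (submatrix G UNIV J $$ (i, j)) (row_degree G i)) =
      submatrix (lead_row_mat G) UNIV J"
  proof (rule eq_matI)
    have c: "submatrix (lead_row_mat G) UNIV J \<in> carrier_mat k k"
      using submatrix_UNIV_carrier[of "lead_row_mat G" k n J] G J by simp
    then show "dim_row (mat k k (\<lambda>(i, j). coeff (submatrix G UNIV J $$ (i, j)) (row_degree G i))) =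
        dim_row (submatrix (lead_row_mat G) UNIV J)"
      "dim_col (mat k k (\<lambda>(i, j). coeff (submatrix G UNIV J $$ (i, j)) (row_degree G i))) =
        dim_col (submatrix (lead_row_mat G) UNIV J)" by auto
    fix i j assume "i < dim_row (submatrix (lead_row_mat G) UNIV J)"
      "j < dim_col (submatrix (lead_row_mat G) UNIV J)"
    then have ij: "i < k" "j < k" using c by auto
    then show "mat k k (\<lambda>(i, j). coeff (submatrix G UNIV J $$ (i, j)) (row_degree G i)) $$ (i, j) =
        submatrix (lead_row_mat G) UNIV J $$ (i, j)"
      using submatrix_UNIV_index[of "lead_row_mat G" k n J i j] p[OF ij] G J
      by (simp add: lead_row_mat_def)
  qed
  then show "coeff (det (submatrix G UNIV J)) (state_dim G) = det (submatrix (lead_row_mat G) UNIV J)"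
    unfolding sd using degree_det_le_and_coeff(2)[OF s d] by simp
qed

definition row_reduced :: "'a::field poly mat \<Rightarrow> bool"
  where "row_reduced G \<longleftrightarrow>
    (\<forall>u\<in>carrier_vec (dim_row G). u \<^sub>v* lead_row_mat G = 0\<^sub>v (dim_col G) \<longrightarrow> u = 0\<^sub>v (dim_row G))"

lemma dim_row_le_if_generator_matrix:
  fixes G :: "'a::{field,finite} poly mat"
  assumes "generator_matrix n \<C> G"
  shows "dim_row G \<le> n"
  by (rule generator_matrixE[OF assms]) (rule right_inverse_imp_dim_le)

text \<open>A trivial left kernel yields a nonzero full-size minor of the leading coefficient
  matrix; the minor of \<open>G\<close> with the same columns then attains the degree bound.\<close>

lemma max_minor_degree_row_reduced:
  fixes G :: "'a::{field,finite} poly mat"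
  assumes "generator_matrix n \<C> G" "row_reduced G"
  shows "max_minor_degree G = state_dim G"
proof -
  obtain k where G: "G \<in> carrier_mat k n"
    using generator_matrixE[OF assms(1)] by metis
  obtain J where J: "J \<subseteq> {..<n}" "card J = k" "det (submatrix (lead_row_mat G) UNIV J) \<noteq> 0"
  proof (rule nonzero_minor_if_trivial_left_kernel)
    show "lead_row_mat G \<in> carrier_mat k n" using G by simp
    show "u = 0\<^sub>v k" if "u \<in> carrier_vec k" "u \<^sub>v* lead_row_mat G = 0\<^sub>v n" for u
      using assms(2) that G unfolding row_reduced_def by auto
  qed
  have "degree (det (submatrix G UNIV J)) = state_dim G"
    using minor_degree_le_and_coeff[OF G J(1,2)] J(3) le_degree[of "det (submatrix G UNIV J)" "state_dim G"]
    by (intro antisym) auto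
  moreover have "finite {degree (det (submatrix G UNIV J)) | J. J \<subseteq> {..<n} \<and> card J = k}"
    by (rule finite_subset[OF _ finite_imageI[of "Pow {..<n}" "\<lambda>J. degree (det (submatrix G UNIV J))"]]) auto
  moreover have "degree (det (submatrix G UNIV J)) \<le> state_dim G" if "J \<subseteq> {..<n} \<and> card J = k" for J
    using minor_degree_le_and_coeff(1)[OF G] that by blast
  ultimately show ?thesis
    using J(1,2) G unfolding max_minor_degree_def
    by (intro Max_eqI) (auto, metis)
qed

lemma const_vec_times_mat_eq_0:
  fixes G :: "'a::field poly mat"
  assumes "G \<in> carrier_mat k n" "H \<in> carrier_mat n k" "G * H = 1\<^sub>m k" "u \<in> carrier_vec k"
    and "map_vec (\<lambda>c. [:c:]) u \<^sub>v* G = 0\<^sub>v n"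
  shows "u = 0\<^sub>v k"
proof -
  have "map_vec (\<lambda>c. [:c:]) u = 0\<^sub>v k"
    using right_invertible_imp_inj[OF assms(1-3), THEN inj_onD, of "map_vec (\<lambda>c. [:c:]) u" "0\<^sub>v k"]
      assms by simp
  then have "map_vec (\<lambda>c. [:c:]) u $ i = 0" if "i < k" for i using that by simp
  then show ?thesis using assms(4) by (intro eq_vecI) auto
qed

lemma row_reduced_if_max_minor_degree:
  fixes G :: "'a::{field,finite} poly mat"
  assumes gen: "generator_matrix n \<C> G" and max: "max_minor_degree G = state_dim G"
  shows "row_reduced G"
proof -
  define k where "k = dim_row G"
  obtain H where G: "G \<in> carrier_mat k n" and H: "H \<in> carrier_mat n k" "G * H = 1\<^sub>m k"
    by (rule generator_matrixE[OF gen, folded k_def])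
  have L: "lead_row_mat G \<in> carrier_mat k n" using G by simp
  have "u = 0\<^sub>v k" if u: "u \<in> carrier_vec k" "u \<^sub>v* lead_row_mat G = 0\<^sub>v n" for u
  \<comment> \<open>A minor of degree 0 may be the zero polynomial, so attaining the bound 0 reveals
    nothing about leading coefficients. In that case, however, \<open>G\<close> is constant and
    equals its leading coefficient matrix, and the right inverse gives the claim.\<close>
  proof (cases "state_dim G = 0")
    case True
    then have r0: "row_degree G i = 0" if "i < k" for i
      using that G by (simp add: state_dim_eq_sum)
    have "map_vec (\<lambda>c. [:c:]) u \<^sub>v* G = 0\<^sub>v n"
    proof (rule eq_vecI)
      fix j assume "j < dim_vec (0\<^sub>v n :: 'a poly vec)"
      then have j: "j < n" by simp
      have e: "G $$ (i, j) = [:lead_row_mat G $$ (i, j):]" if "i < k" for i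
        using degree_le_row_degree[of j G i] r0[OF that] G j that
        by (auto simp: lead_row_mat_def elim!: degree_eq_zeroE)
      have "(map_vec (\<lambda>c. [:c:]) u \<^sub>v* G) $ j = (\<Sum>i<k. [:u $ i * lead_row_mat G $$ (i, j):])"
        using G u j by (subst vec_times_mat_index) (auto intro!: sum.cong simp: e)
      also have "\<dots> = [:(u \<^sub>v* lead_row_mat G) $ j:]"
        using L u j by (subst vec_times_mat_index) (auto simp: poly_eq_iff coeff_sum coeff_pCons split: nat.split)
      finally show "(map_vec (\<lambda>c. [:c:]) u \<^sub>v* G) $ j = 0\<^sub>v n $ j" using u j by simp
    qed (use G in auto)
    then show ?thesis by (rule const_vec_times_mat_eq_0[OF G H u(1)])
  next
    case False
    have "k \<le> n" using dim_row_le_if_generator_matrix[OF gen] by (simp add: k_def)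
    then have "{..<k} \<subseteq> {..<n} \<and> card {..<k} = k" by auto
    then have "{degree (det (submatrix G UNIV J)) | J. J \<subseteq> {..<n} \<and> card J = k} \<noteq> {}" by blast
    moreover have "finite {degree (det (submatrix G UNIV J)) | J. J \<subseteq> {..<n} \<and> card J = k}"
      by (rule finite_subset[OF _ finite_imageI[of "Pow {..<n}" "\<lambda>J. degree (det (submatrix G UNIV J))"]]) auto
    ultimately have "Max {degree (det (submatrix G UNIV J)) | J. J \<subseteq> {..<n} \<and> card J = k}
        \<in> {degree (det (submatrix G UNIV J)) | J. J \<subseteq> {..<n} \<and> card J = k}"
      by (intro Max_in)
    then have "max_minor_degree G \<in> {degree (det (submatrix G UNIV J)) | J. J \<subseteq> {..<n} \<and> card J = k}"
      unfolding max_minor_degree_def carrier_matD[OF G] .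
    then obtain J where J: "J \<subseteq> {..<n}" "card J = k" "degree (det (submatrix G UNIV J)) = state_dim G"
      using max by auto
    have "det (submatrix G UNIV J) \<noteq> 0" using J(3) False by auto
    then have "coeff (det (submatrix G UNIV J)) (state_dim G) \<noteq> 0" using J(3) by (metis leading_coeff_0_iff)
    then have "det (submatrix (lead_row_mat G) UNIV J) \<noteq> 0"
      using minor_degree_le_and_coeff(2)[OF G J(1,2)] by simp
    moreover have s: "submatrix (lead_row_mat G) UNIV J \<in> carrier_mat k k"
      using submatrix_UNIV_carrier[OF L J(1)] J(2) by simp
    moreover have "u \<^sub>v* submatrix (lead_row_mat G) UNIV J = 0\<^sub>v k"
    proof (rule eq_vecI)
      fix j assume "j < dim_vec (0\<^sub>v k :: 'a vec)"
      then have j: "j < card J" using J by simp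
      have p: "pick J j < n"
        if "k > 0" using submatrix_UNIV_index(2)[OF L J(1) that j] .
      have k: "k > 0" using j J(2) by simp
      have "(u \<^sub>v* submatrix (lead_row_mat G) UNIV J) $ j =
          (\<Sum>i<k. u $ i * submatrix (lead_row_mat G) UNIV J $$ (i, j))"
        using s u j J by (subst vec_times_mat_index) auto
      also have "\<dots> = (\<Sum>i<k. u $ i * lead_row_mat G $$ (i, pick J j))"
        using submatrix_UNIV_index(1)[OF L J(1) _ j] by (intro sum.cong) auto
      also have "\<dots> = (u \<^sub>v* lead_row_mat G) $ pick J j"
        using L u p[OF k] by (subst vec_times_mat_index) auto
      finally show "(u \<^sub>v* submatrix (lead_row_mat G) UNIV J) $ j = 0\<^sub>v k $ j"
        using u p[OF k] j J by simp
    qed (use s in auto)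
    ultimately show ?thesis using det_zero_if_left_kernel u(1) by blast
  qed
  then show ?thesis using G unfolding row_reduced_def by auto
qed

section \<open>Row reduction and existence of minimal generator matrices\<close>

text \<open>As a left factor it performs a row operation: row \<open>i\<^sub>0\<close> is exchanged
  for the combination of all rows with coefficients \<open>c\<close>.\<close>

definition replace_row_mat :: "nat \<Rightarrow> nat \<Rightarrow> (nat \<Rightarrow> 'a) \<Rightarrow> 'a::comm_ring_1 mat"
  where "replace_row_mat k i\<^sub>0 c =
    mat k k (\<lambda>(i, j). if i = i\<^sub>0 then c j else if i = j then 1 else 0)"

lemma replace_row_mat_carrier [simp]: "replace_row_mat k i\<^sub>0 c \<in> carrier_mat k k"
  by (simp add: replace_row_mat_def)

lemma replace_row_mat_mult_index:
  assumes "i\<^sub>0 < k" "M \<in> carrier_mat k n" "i < k" "j < n"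
  shows "(replace_row_mat k i\<^sub>0 c * M) $$ (i, j) =
    (if i = i\<^sub>0 then \<Sum>l<k. c l * M $$ (l, j) else M $$ (i, j))"
proof -
  have "(replace_row_mat k i\<^sub>0 c * M) $$ (i, j) =
      (\<Sum>l<k. (if i = i\<^sub>0 then c l else if i = l then 1 else 0) * M $$ (l, j))"
    using assms by (auto simp: replace_row_mat_def scalar_prod_def atLeast0LessThan intro!: sum.cong)
  also have "\<dots> = (if i = i\<^sub>0 then \<Sum>l<k. c l * M $$ (l, j) else M $$ (i, j))"
  proof (cases "i = i\<^sub>0")
    case False
    then have "(\<Sum>l<k. (if i = i\<^sub>0 then c l else if i = l then 1 else 0) * M $$ (l, j)) =
        (\<Sum>l<k. if i = l then M $$ (l, j) else 0)" by (intro sum.cong) auto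
    then show ?thesis using False assms(3) by simp
  qed simp
  finally show ?thesis .
qed

lemma replace_row_mat_mult_replace_row_mat:
  assumes "i\<^sub>0 < k" and "c i\<^sub>0 * d i\<^sub>0 = 1" and "\<And>j. j < k \<Longrightarrow> j \<noteq> i\<^sub>0 \<Longrightarrow> c i\<^sub>0 * d j + c j = 0"
  shows "replace_row_mat k i\<^sub>0 c * replace_row_mat k i\<^sub>0 d = 1\<^sub>m k"
proof (rule eq_matI)
  fix i j assume "i < dim_row (1\<^sub>m k :: 'a mat)" "j < dim_col (1\<^sub>m k :: 'a mat)"
  then have ij: "i < k" "j < k" by auto
  have "(\<Sum>l<k. c l * replace_row_mat k i\<^sub>0 d $$ (l, j)) =
      c i\<^sub>0 * d j + (\<Sum>l\<in>{..<k} - {i\<^sub>0}. c l * replace_row_mat k i\<^sub>0 d $$ (l, j))"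
    using assms(1) ij by (subst sum.remove[of _ i\<^sub>0]) (auto simp: replace_row_mat_def)
  also have "(\<Sum>l\<in>{..<k} - {i\<^sub>0}. c l * replace_row_mat k i\<^sub>0 d $$ (l, j)) =
      (\<Sum>l\<in>{..<k} - {i\<^sub>0}. if l = j then c l else 0)"
    using ij by (intro sum.cong) (auto simp: replace_row_mat_def)
  also have "\<dots> = (if j = i\<^sub>0 then 0 else c j)" using ij by auto
  also have "c i\<^sub>0 * d j + \<dots> = (if j = i\<^sub>0 then 1 else 0)" using assms(2,3) ij by auto
  finally show "(replace_row_mat k i\<^sub>0 c * replace_row_mat k i\<^sub>0 d) $$ (i, j) = 1\<^sub>m k $$ (i, j)"
    using ij assms(1) replace_row_mat_mult_index[OF assms(1) replace_row_mat_carrier[of k i\<^sub>0 d] ij, where c = c]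
    by (auto simp: replace_row_mat_def)
qed (simp_all add: replace_row_mat_def)

lemma replace_row_mat_unimodular:
  fixes c :: "nat \<Rightarrow> 'a::field poly"
  assumes i: "i\<^sub>0 < k" and c: "c i\<^sub>0 = [:a:]" "a \<noteq> 0"
  obtains V where "V \<in> carrier_mat k k" "replace_row_mat k i\<^sub>0 c * V = 1\<^sub>m k"
    "V * replace_row_mat k i\<^sub>0 c = 1\<^sub>m k"
proof
  \<comment> \<open>Solving the new row for the old row \<open>i\<^sub>0\<close> gives these
    coefficients. The division is possible because the coefficient of that row is a nonzero
    constant, a unit among polynomials.\<close>
  define d where "d = (\<lambda>j. if j = i\<^sub>0 then [:1 / a:] else - ([:1 / a:] * c j))"
  show "replace_row_mat k i\<^sub>0 d \<in> carrier_mat k k" by simp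
  have [simp]: "[:a:] * ([:1 / a:] * p) = p" for p using c(2) by simp
  show "replace_row_mat k i\<^sub>0 c * replace_row_mat k i\<^sub>0 d = 1\<^sub>m k"
    using c by (intro replace_row_mat_mult_replace_row_mat i) (auto simp: d_def)
  show "replace_row_mat k i\<^sub>0 d * replace_row_mat k i\<^sub>0 c = 1\<^sub>m k"
    using c by (intro replace_row_mat_mult_replace_row_mat i) (auto simp: d_def)
qed

lemma generator_matrix_row_nonzero:
  fixes G :: "'a::field poly mat"
  assumes "generator_matrix n \<C> G" "i < dim_row G"
  obtains j where "j < n" "G $$ (i, j) \<noteq> 0"
proof -
  define k where "k = dim_row G"
  obtain H where G: "G \<in> carrier_mat k n" and H: "H \<in> carrier_mat n k" "G * H = 1\<^sub>m k"
    by (rule generator_matrixE[OF assms(1), folded k_def])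
  have i: "i < k" using assms(2) k_def by simp
  have "\<exists>j<n. G $$ (i, j) \<noteq> 0"
  proof (rule ccontr)
    assume "\<not> (\<exists>j<n. G $$ (i, j) \<noteq> 0)"
    then have "(G * H) $$ (i, i) = 0" using G H(1) i by (simp add: scalar_prod_def)
    then show False using H(2) i by simp
  qed
  then show ?thesis using that by blast
qed

text \<open>A left kernel vector \<open>u\<close> of the leading coefficient matrix is a relation
  between leading coefficients. Raising the rows involved by powers of \<open>z\<close> to their
  largest degree and combining them with \<open>u\<close> cancels that degree, and the combination
  can replace a row of this largest degree.\<close>

lemma row_reduction_step:
  fixes G :: "'a::{field,finite} poly mat"
  assumes gen: "generator_matrix n \<C> G" and "\<not> row_reduced G"
  obtains G' where "generator_matrix n \<C> G'" "state_dim G' < state_dim G"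
proof -
  define k where "k = dim_row G"
  have G: "G \<in> carrier_mat k n"
    using gen unfolding k_def by (auto simp: generator_matrix_def)
  have L: "lead_row_mat G \<in> carrier_mat k n" using G by simp
  obtain u where u: "u \<in> carrier_vec k" "u \<^sub>v* lead_row_mat G = 0\<^sub>v n" "u \<noteq> 0\<^sub>v k"
    using assms(2) G unfolding row_reduced_def by auto
  define S where "S = {i. i < k \<and> u $ i \<noteq> 0}"
  have S: "finite S" "S \<noteq> {}"
  proof -
    show "S \<noteq> {}"
    proof
      assume "S = {}"
      then have "u = 0\<^sub>v k" using u(1) unfolding S_def by (intro eq_vecI) auto
      then show False using u(3) by simp
    qed
  qed (simp add: S_def)
  have "Max (row_degree G ` S) \<in> row_degree G ` S" using S by simp
  then obtain i\<^sub>0 where i0: "i\<^sub>0 \<in> S" "row_degree G i\<^sub>0 = Max (row_degree G ` S)" by auto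
  then have max: "row_degree G l \<le> row_degree G i\<^sub>0" if "l \<in> S" for l using S(1) that by simp
  from i0(1) have ik: "i\<^sub>0 < k" "u $ i\<^sub>0 \<noteq> 0" unfolding S_def by auto
  \<comment> \<open>Truncation of the exponent is harmless: if row \<open>l\<close> has larger
    degree than row \<open>i\<^sub>0\<close>, then \<open>u $ l = 0\<close>. At
    \<open>i\<^sub>0\<close> the exponent is 0, so the operation is unimodular.\<close>
  define c where "c = (\<lambda>l. monom (u $ l) (row_degree G i\<^sub>0 - row_degree G l))"
  define G' where "G' = replace_row_mat k i\<^sub>0 c * G"
  have "c i\<^sub>0 = [:u $ i\<^sub>0:]" by (simp add: c_def monom_0)
  then obtain V where "V \<in> carrier_mat k k" "replace_row_mat k i\<^sub>0 c * V = 1\<^sub>m k"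
    "V * replace_row_mat k i\<^sub>0 c = 1\<^sub>m k"
    using replace_row_mat_unimodular[OF ik(1) _ ik(2)] by metis
  then have gen': "generator_matrix n \<C> G'"
    unfolding G'_def by (intro generator_matrix_unimodular[OF gen G]) simp_all
  have G': "G' \<in> carrier_mat k n" unfolding G'_def using G by (intro mult_carrier_mat[of _ k k]) simp_all
  have entry: "degree (G' $$ (i\<^sub>0, j)) \<le> row_degree G i\<^sub>0 \<and> coeff (G' $$ (i\<^sub>0, j)) (row_degree G i\<^sub>0) = 0"
    if j: "j < n" for j
  proof -
    have e: "G' $$ (i\<^sub>0, j) = (\<Sum>l<k. c l * G $$ (l, j))"
      unfolding G'_def using replace_row_mat_mult_index[OF ik(1) G ik(1) j, of c] by simp
    have t: "degree (c l * G $$ (l, j)) \<le> row_degree G i\<^sub>0 \<and>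
        coeff (c l * G $$ (l, j)) (row_degree G i\<^sub>0) = u $ l * lead_row_mat G $$ (l, j)" if l: "l < k" for l
    proof (cases "u $ l = 0")
      case False
      then have le: "row_degree G l \<le> row_degree G i\<^sub>0" using max l unfolding S_def by auto
      have dl: "degree (G $$ (l, j)) \<le> row_degree G l" using degree_le_row_degree[of j G l] G j by simp
      have "degree (c l * G $$ (l, j)) \<le> degree (c l) + degree (G $$ (l, j))" by (rule degree_mult_le)
      also have "\<dots> \<le> (row_degree G i\<^sub>0 - row_degree G l) + row_degree G l"
        using dl degree_monom_le[of "u $ l"] unfolding c_def by (rule add_mono[rotated])
      finally show ?thesis
        using le l j G by (simp add: c_def coeff_monom_mult lead_row_mat_def)
    qed (simp add: c_def)
    have "coeff (G' $$ (i\<^sub>0, j)) (row_degree G i\<^sub>0) = (\<Sum>l<k. u $ l * lead_row_mat G $$ (l, j))"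
      using t by (simp add: e coeff_sum)
    also have "\<dots> = (u \<^sub>v* lead_row_mat G) $ j" using L u(1) j by (subst vec_times_mat_index) auto
    finally show ?thesis using u(2) j t unfolding e by (auto intro!: degree_sum_le)
  qed
  \<comment> \<open>A zero row would count as degree 0, with no decrease from 0. Cancelling a
    constant row would produce exactly such a row, which a basic matrix cannot have.\<close>
  have pos: "row_degree G i\<^sub>0 > 0"
  proof (rule ccontr)
    assume z: "\<not> row_degree G i\<^sub>0 > 0"
    obtain j where "j < n" "G' $$ (i\<^sub>0, j) \<noteq> 0"
      using generator_matrix_row_nonzero[OF gen', of i\<^sub>0] ik(1) G' by auto
    then show False using entry[of j] z by (metis gr0I le_zero_eq leading_coeff_0_iff)
  qed
  have n: "n > 0" using dim_row_le_if_generator_matrix[OF gen] ik(1) k_def by simp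
  have "degree (G' $$ (i\<^sub>0, j)) < row_degree G i\<^sub>0" if "j < n" for j
    using entry[OF that] pos by (metis degree_0 leading_coeff_0_iff nat_less_le)
  then have less: "row_degree G' i\<^sub>0 < row_degree G i\<^sub>0"
    using n G' by (intro row_degree_less) auto
  have "row_degree G' i = row_degree G i" if "i < k" "i \<noteq> i\<^sub>0" for i
  proof -
    have "G' $$ (i, j) = G $$ (i, j)" if "j < n" for j
      unfolding G'_def using replace_row_mat_mult_index[OF ik(1) G \<open>i < k\<close> that, of c] \<open>i \<noteq> i\<^sub>0\<close> by simp
    then have "{degree (G' $$ (i, j)) | j. j < n} = {degree (G $$ (i, j)) | j. j < n}"
      by (intro Collect_cong ex_cong1) auto
    then show ?thesis using G G' unfolding row_degree_def by simp
  qed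
  then have "(\<Sum>i<k. row_degree G' i) < (\<Sum>i<k. row_degree G i)"
    using less ik(1) by (intro sum_strict_mono_ex1) (auto, metis order.refl less_imp_le)
  then show ?thesis using that[OF gen'] G G' by (simp add: state_dim_eq_sum)
qed

lemma ex_row_reduced_generator_matrix:
  fixes G :: "'a::{field,finite} poly mat"
  assumes "generator_matrix n \<C> G"
  shows "\<exists>G'. generator_matrix n \<C> G' \<and> row_reduced G'"
  using assms
proof (induction "state_dim G" arbitrary: G rule: less_induct)
  case less
  show ?case
  proof (cases "row_reduced G")
    case False
    then show ?thesis using row_reduction_step[OF less.prems] less.hyps by metis
  qed (use less.prems in blast)
qed

text \<open>The overall constraint length can be computed from \<open>G\<close> itself, so
  minimality says that the minors of \<open>G\<close> attain the bound given by the row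
  degrees.\<close>

lemma minimal_generator_matrix_iff_row_reduced:
  fixes G :: "'a::{field,finite} poly mat"
  shows "minimal_generator_matrix n \<C> G \<longleftrightarrow> generator_matrix n \<C> G \<and> row_reduced G"
  using max_minor_degree_row_reduced row_reduced_if_max_minor_degree overall_constraint_length_eq
  unfolding minimal_generator_matrix_def by metis

lemma ex_minimal_generator_matrix:
  fixes \<C> :: "'a::{field,finite} fls vec set"
  assumes "convolutional_code n k \<C>"
  shows "\<exists>G. minimal_generator_matrix n \<C> G"
  using assms ex_row_reduced_generator_matrix
  unfolding convolutional_code_def minimal_generator_matrix_iff_row_reduced by blast

section \<open>Forney indices\<close>

text \<open>
  Counting polynomial codewords of bounded degree shows that the sums \<open>\<Sum>\<^sub>i max 0 (r - \<gamma>\<^sub>i)\<close> depend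
  only on the code; their second differences in \<open>r\<close> recover the multiset of the \<open>\<gamma>\<^sub>i\<close>.
\<close>

lemma card_degree_bounded_polys:
  "card {p :: 'a::{field,finite} poly. \<forall>m\<ge>d. coeff p m = 0} = CARD('a) ^ d"
proof (induction d)
  case 0
  have "{p :: 'a poly. \<forall>m\<ge>0. coeff p m = 0} = {0}" by (auto simp: poly_eq_iff)
  then show ?case by simp
next
  case (Suc d)
  have "{p :: 'a poly. \<forall>m\<ge>Suc d. coeff p m = 0} =
      (\<lambda>(a, p). pCons a p) ` (UNIV \<times> {p. \<forall>m\<ge>d. coeff p m = 0})" (is "?L = ?R")
  proof
    show "?L \<subseteq> ?R"
    proof
      fix p assume p: "p \<in> ?L"
      obtain a q where "p = pCons a q" by (cases p)
      moreover from this p have "\<forall>m\<ge>d. coeff q m = 0"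
        by (metis (mono_tags, lifting) Suc_le_mono coeff_pCons_Suc mem_Collect_eq)
      ultimately show "p \<in> ?R" by force
    qed
    show "?R \<subseteq> ?L" by (auto simp: coeff_pCons split: nat.splits)
  qed
  moreover have "inj_on (\<lambda>(a, p). pCons a p) (UNIV \<times> {p :: 'a poly. \<forall>m\<ge>d. coeff p m = 0})"
    by (auto intro!: inj_onI)
  ultimately show ?case using Suc by (simp add: card_image card_cartesian_product)
qed

text \<open>Known as the predictable degree property: with independent leading rows the top terms of
  a combination cannot cancel. Vanishing coefficients express the bounds so that zero polynomials
  and bounds below 0 need no separate treatment.\<close>

lemma predictable_degree:
  fixes G :: "'a::field poly mat"
  assumes G: "G \<in> carrier_mat k n" and red: "row_reduced G" and v: "v \<in> carrier_vec k"
  shows "(\<forall>j<n. \<forall>m\<ge>r. coeff ((v \<^sub>v* G) $ j) m = 0) \<longleftrightarrow>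
    (\<forall>i<k. \<forall>m\<ge>r - row_degree G i. coeff (v $ i) m = 0)" (is "?L \<longleftrightarrow> ?R")
proof
  assume R: ?R
  show ?L
  proof (intro allI impI)
    fix j m assume j: "j < n" and m: "m \<ge> r"
    have "coeff (v $ i) s * coeff (G $$ (i, j)) (m - s) = 0" if "i < k" for i s
    proof (cases "s \<ge> r - row_degree G i")
      case True
      then show ?thesis using R that by simp
    next
      case False
      then have "degree (G $$ (i, j)) < m - s"
        using degree_le_row_degree[of j G i] G j m by simp
      then show ?thesis by (simp add: coeff_eq_0)
    qed
    then show "coeff ((v \<^sub>v* G) $ j) m = 0"
      using G v j
      by (subst vec_times_mat_index) (auto simp: coeff_sum coeff_mult simp del: mult_eq_0_iff intro!: sum.neutral)
  qed
next
  assume L: ?L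
  show ?R
  proof (rule ccontr)
    assume "\<not> ?R"
    then obtain i\<^sub>0 m\<^sub>0 where im: "i\<^sub>0 < k" "m\<^sub>0 \<ge> r - row_degree G i\<^sub>0" "coeff (v $ i\<^sub>0) m\<^sub>0 \<noteq> 0" by blast
    \<comment> \<open>These are the formal degrees of the terms of \<open>v\<close> times
      \<open>G\<close>. Their maximum \<open>M\<close> is at least \<open>r\<close> by the assumed
      violation.\<close>
    define T where "T = {m + row_degree G i | m i. i < k \<and> coeff (v $ i) m \<noteq> 0}"
    have "T \<subseteq> (\<Union>i<k. (\<lambda>m. m + row_degree G i) ` {..degree (v $ i)})"
      unfolding T_def using le_degree by fastforce
    then have fin: "finite T" by (rule finite_subset) auto
    have T0: "m\<^sub>0 + row_degree G i\<^sub>0 \<in> T" using im unfolding T_def by blast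
    define M where "M = Max T"
    have M: "M \<in> T" "M \<ge> r"
      using Max_in[OF fin] Max_ge[OF fin T0] T0 im(2) unfolding M_def by auto
    have top: "m + row_degree G i \<le> M" if "i < k" "coeff (v $ i) m \<noteq> 0" for i m
      unfolding M_def using that by (intro Max_ge[OF fin]) (auto simp: T_def)
    \<comment> \<open>The coefficients of \<open>v\<close> whose terms reach formal degree
      \<open>M\<close>. Their combination of leading rows is the coefficient of \<open>v\<close>
      times \<open>G\<close> at \<open>M\<close>, which vanishes, although some coordinate of
      \<open>u\<close> is nonzero.\<close>
    define u where "u = vec k (\<lambda>i. if row_degree G i \<le> M then coeff (v $ i) (M - row_degree G i) else 0)"
    have "u \<^sub>v* lead_row_mat G = 0\<^sub>v n"
    proof (rule eq_vecI)
      fix j assume "j < dim_vec (0\<^sub>v n :: 'a vec)"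
      then have j: "j < n" by simp
      have c: "coeff (v $ i * G $$ (i, j)) M = u $ i * lead_row_mat G $$ (i, j)" if i: "i < k" for i
      proof -
        have d: "degree (G $$ (i, j)) \<le> row_degree G i" using degree_le_row_degree[of j G i] G j by simp
        have "coeff (v $ i * G $$ (i, j)) M = (\<Sum>s\<le>M. coeff (v $ i) s * coeff (G $$ (i, j)) (M - s))"
          by (rule coeff_mult)
        also have "\<dots> = (\<Sum>s\<le>M. if s = M - row_degree G i \<and> row_degree G i \<le> M
            then u $ i * lead_row_mat G $$ (i, j) else 0)"
        proof (intro sum.cong refl)
          fix s assume s: "s \<in> {..M}"
          show "coeff (v $ i) s * coeff (G $$ (i, j)) (M - s) =
              (if s = M - row_degree G i \<and> row_degree G i \<le> M then u $ i * lead_row_mat G $$ (i, j) else 0)"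
          proof (cases "s = M - row_degree G i \<and> row_degree G i \<le> M")
            case True
            then show ?thesis using i j G by (simp add: u_def lead_row_mat_def)
          next
            case False
            have "coeff (v $ i) s = 0 \<or> degree (G $$ (i, j)) < M - s"
              using top[OF i, of s] False d s by force
            then show ?thesis using False by (auto simp: coeff_eq_0)
          qed
        qed
        also have "\<dots> = u $ i * lead_row_mat G $$ (i, j)"
          using i by (cases "row_degree G i \<le> M") (simp_all add: u_def)
        finally show ?thesis .
      qed
      have "(u \<^sub>v* lead_row_mat G) $ j = (\<Sum>i<k. u $ i * lead_row_mat G $$ (i, j))"
        using G j by (subst vec_times_mat_index) (auto simp: u_def lead_row_mat_def)
      also have "\<dots> = coeff ((v \<^sub>v* G) $ j) M"
        using G v j c by (subst vec_times_mat_index) (auto simp: coeff_sum)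
      also have "\<dots> = 0" using L j M(2) by blast
      finally show "(u \<^sub>v* lead_row_mat G) $ j = 0\<^sub>v n $ j" using j by simp
    qed (use G in \<open>auto simp: lead_row_mat_def\<close>)
    then have "u = 0\<^sub>v k" using red G unfolding row_reduced_def by (auto simp: u_def)
    moreover obtain i m where "i < k" "coeff (v $ i) m \<noteq> 0" "M = m + row_degree G i"
      using M(1) unfolding T_def by blast
    then have "u $ i \<noteq> 0 \<and> i < k" by (simp add: u_def)
    ultimately show False by auto
  qed
qed

text \<open>Encoding is injective and, onto polynomial codewords, comes from polynomial messages. By
  the predictable degree property, coordinate \<open>i\<close> of the message has
  \<open>r - row_degree G i\<close> free coefficients.\<close>

lemma card_degree_bounded_codewords:
  fixes G :: "'a::{field,finite} poly mat"
  assumes "minimal_generator_matrix n \<C> G"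
  shows "card {w \<in> carrier_vec n. map_vec fls_of_poly w \<in> \<C> \<and> (\<forall>j<n. \<forall>m\<ge>r. coeff (w $ j) m = 0)} =
    CARD('a) ^ (\<Sum>i<dim_row G. r - row_degree G i)"
proof -
  have gen: "generator_matrix n \<C> G" and red: "row_reduced G"
    using assms by (auto simp: minimal_generator_matrix_iff_row_reduced)
  define k where "k = dim_row G"
  obtain H where G: "G \<in> carrier_mat k n" and H: "H \<in> carrier_mat n k" "G * H = 1\<^sub>m k"
    and C: "\<C> = code_of G"
    by (rule generator_matrixE[OF gen, folded k_def])
  define V :: "'a poly vec set" where "V = {v \<in> carrier_vec k. \<forall>i<k. v $ i \<in> {p. \<forall>m\<ge>r - row_degree G i. coeff p m = 0}}"
  have "{w \<in> carrier_vec n. map_vec fls_of_poly w \<in> \<C> \<and> (\<forall>j<n. \<forall>m\<ge>r. coeff (w $ j) m = 0)} =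
      (\<lambda>v. v \<^sub>v* G) ` V" (is "?W = _")
  proof
    show "?W \<subseteq> (\<lambda>v. v \<^sub>v* G) ` V"
    proof
      fix w assume "w \<in> ?W"
      then have w: "w \<in> carrier_vec n" "w = w \<^sub>v* H \<^sub>v* G" "\<forall>j<n. \<forall>m\<ge>r. coeff (w $ j) m = 0"
        using polynomial_codewords[OF G H, of w] C by auto
      have c: "w \<^sub>v* H \<in> carrier_vec k" using H by simp
      have "\<forall>j<n. \<forall>m\<ge>r. coeff ((w \<^sub>v* H \<^sub>v* G) $ j) m = 0"
        unfolding w(2)[symmetric] by (rule w(3))
      then have "w \<^sub>v* H \<in> V"
        unfolding predictable_degree[OF G red c] V_def using c by simp
      then show "w \<in> (\<lambda>v. v \<^sub>v* G) ` V" using w(2) by (rule rev_image_eqI)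
    qed
    show "(\<lambda>v. v \<^sub>v* G) ` V \<subseteq> ?W"
    proof (rule image_subsetI)
      fix v assume "v \<in> V"
      then have v: "v \<in> carrier_vec k" "\<forall>i<k. \<forall>m\<ge>r - row_degree G i. coeff (v $ i) m = 0"
        by (auto simp: V_def)
      have "v \<^sub>v* G \<^sub>v* H = v" using vec_times_mat_assoc[OF v(1) G H(1)] H(2) v(1) by simp
      then have "map_vec fls_of_poly (v \<^sub>v* G) \<in> \<C>"
        unfolding C using polynomial_codewords[OF G H, of "v \<^sub>v* G"] G by simp
      then show "v \<^sub>v* G \<in> ?W"
        using predictable_degree[OF G red v(1), of r] v(2) G by simp
    qed
  qed
  moreover have "inj_on (\<lambda>v. v \<^sub>v* G) V"
    by (rule inj_on_subset[OF right_invertible_imp_inj[OF G H]]) (auto simp: V_def)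
  ultimately show ?thesis
    unfolding V_def
    by (simp only: card_image card_vec_PiE card_degree_bounded_polys power_sum k_def)
qed

text \<open>Passing from \<open>r\<close> to \<open>Suc r\<close> raises a summand by 1 exactly for
  entries at most \<open>r\<close>, so the increments count such entries. Multiplicities are
  differences of these counts; that of 0 is the count at \<open>r = 0\<close> itself.\<close>

lemma mset_eq_if_truncated_sums_eq:
  fixes xs ys :: "nat list"
  assumes eq: "\<And>r. (\<Sum>x\<leftarrow>xs. r - x) = (\<Sum>y\<leftarrow>ys. r - y)"
  shows "mset xs = mset ys"
proof (rule multiset_eqI)
  have step: "(\<Sum>x\<leftarrow>zs. Suc r - x) = (\<Sum>x\<leftarrow>zs. r - x) + length (filter (\<lambda>x. x \<le> r) zs)"
    for zs :: "nat list" and r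
    by (induction zs) (auto simp: Suc_diff_le)
  have le: "length (filter (\<lambda>x. x \<le> r) xs) = length (filter (\<lambda>x. x \<le> r) ys)" for r
    using step[where zs = xs and r = r] step[where zs = ys and r = r] eq[of r] eq[of "Suc r"] by simp
  have cnt: "count (mset zs) (Suc r) + length (filter (\<lambda>x. x \<le> r) zs) = length (filter (\<lambda>x. x \<le> Suc r) zs)"
    "count (mset zs) 0 = length (filter (\<lambda>x. x \<le> 0) zs)"
    for zs :: "nat list" and r
    by (induction zs) (auto simp: le_Suc_eq)
  show "count (mset xs) a = count (mset ys) a" for a
  proof (cases a)
    case (Suc r)
    then show ?thesis using cnt(1)[of xs r] cnt(1)[of ys r] le[of r] le[of "Suc r"] by simp
  qed (use cnt(2)[of xs] cnt(2)[of ys] le[of 0] in simp)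
qed

lemma sum_list_row_degrees:
  "(\<Sum>d\<leftarrow>row_degrees G. f d) = (\<Sum>i<dim_row G. f (row_degree G i))"
  by (simp add: row_degrees_def interv_sum_list_conv_sum_set_nat atLeast0LessThan o_def)

lemma row_degrees_unique:
  fixes G G' :: "'a::{field,finite} poly mat"
  assumes "minimal_generator_matrix n \<C> G" "minimal_generator_matrix n \<C> G'"
  shows "mset (row_degrees G) = mset (row_degrees G')"
proof (rule mset_eq_if_truncated_sums_eq)
  fix r
  have "CARD('a) ^ (\<Sum>i<dim_row G. r - row_degree G i) =
      CARD('a) ^ (\<Sum>i<dim_row G'. r - row_degree G' i)"
    using card_degree_bounded_codewords[OF assms(1), of r]
      card_degree_bounded_codewords[OF assms(2), of r] by simp
  then show "(\<Sum>x\<leftarrow>row_degrees G. r - x) = (\<Sum>y\<leftarrow>row_degrees G'. r - y)"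
    unfolding sum_list_row_degrees using CARD_field_gt_1[where 'a = 'a] by (metis power_inject_exp)
qed

lemma forney_indices_eq:
  fixes G :: "'a::{field,finite} poly mat"
  assumes "minimal_generator_matrix n \<C> G"
  shows "forney_indices n \<C> = mset (row_degrees G)"
  unfolding forney_indices_def
proof (rule the_equality)
  show "\<exists>G'. minimal_generator_matrix n \<C> G' \<and> mset (row_degrees G) = mset (row_degrees G')"
    using assms by blast
  show "M = mset (row_degrees G)"
    if "\<exists>G. minimal_generator_matrix n \<C> G \<and> M = mset (row_degrees G)" for M
    using that row_degrees_unique[OF _ assms] by blast
qed

section \<open>States reachable from zero\<close>

lemma append_vec_times_diag:
  fixes P Q :: "'a::comm_ring_1 mat"
  assumes P: "P \<in> carrier_mat m\<^sub>1 n\<^sub>1" and Q: "Q \<in> carrier_mat m\<^sub>2 n\<^sub>2"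
    and v: "v\<^sub>1 \<in> carrier_vec m\<^sub>1" "v\<^sub>2 \<in> carrier_vec m\<^sub>2"
  shows "(v\<^sub>1 @\<^sub>v v\<^sub>2) \<^sub>v* four_block_mat P (0\<^sub>m m\<^sub>1 n\<^sub>2) (0\<^sub>m m\<^sub>2 n\<^sub>1) Q = (v\<^sub>1 \<^sub>v* P) @\<^sub>v (v\<^sub>2 \<^sub>v* Q)"
proof -
  have "(four_block_mat P (0\<^sub>m m\<^sub>1 n\<^sub>2) (0\<^sub>m m\<^sub>2 n\<^sub>1) Q)\<^sup>T =
      four_block_mat P\<^sup>T (0\<^sub>m n\<^sub>1 m\<^sub>2) (0\<^sub>m n\<^sub>2 m\<^sub>1) Q\<^sup>T"
    using P Q by (subst transpose_four_block_mat[of _ m\<^sub>1 n\<^sub>1 _ n\<^sub>2 _ m\<^sub>2]) auto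
  then have "(v\<^sub>1 @\<^sub>v v\<^sub>2) \<^sub>v* four_block_mat P (0\<^sub>m m\<^sub>1 n\<^sub>2) (0\<^sub>m m\<^sub>2 n\<^sub>1) Q =
      (P\<^sup>T *\<^sub>v v\<^sub>1 + 0\<^sub>m n\<^sub>1 m\<^sub>2 *\<^sub>v v\<^sub>2) @\<^sub>v (0\<^sub>m n\<^sub>2 m\<^sub>1 *\<^sub>v v\<^sub>1 + Q\<^sup>T *\<^sub>v v\<^sub>2)"
    unfolding vec_times_mat_def
    using P Q v by (subst four_block_mat_mult_vec[symmetric, of _ n\<^sub>1 m\<^sub>1 _ m\<^sub>2 _ n\<^sub>2]) auto
  moreover have "0\<^sub>m n\<^sub>1 m\<^sub>2 *\<^sub>v v\<^sub>2 = 0\<^sub>v n\<^sub>1" "0\<^sub>m n\<^sub>2 m\<^sub>1 *\<^sub>v v\<^sub>1 = 0\<^sub>v n\<^sub>2"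
    using v by (auto intro!: eq_vecI)
  ultimately show ?thesis using P Q v by (simp add: vec_times_mat_def)
qed

text \<open>The state transition depends on \<open>G\<close> only through its list of row degrees.
  Taking that list as the parameter allows induction over the registers.\<close>

abbreviation shift_block :: "nat \<Rightarrow> 'a::field mat"
  where "shift_block d \<equiv> mat d d (\<lambda>(i, j). if j = Suc i then 1 else 0)"

abbreviation input_block :: "nat \<Rightarrow> 'a::field mat"
  where "input_block d \<equiv> mat 1 d (\<lambda>(i, j). if j = 0 then 1 else 0)"

abbreviation shift_mat :: "nat list \<Rightarrow> 'a::field mat"
  where "shift_mat ds \<equiv> diag_block_mat (map shift_block ds)"

abbreviation input_mat :: "nat list \<Rightarrow> 'a::field mat"
  where "input_mat ds \<equiv> diag_block_mat (map input_block ds)"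

lemma shift_mat_carrier: "shift_mat ds \<in> carrier_mat (sum_list ds) (sum_list ds)"
  by (rule carrier_matI) (simp_all add: dim_diag_block_mat o_def)

lemma input_mat_carrier: "input_mat ds \<in> carrier_mat (length ds) (sum_list ds)"
  by (rule carrier_matI) (simp_all add: dim_diag_block_mat o_def sum_list_triv)

lemma append_vec_times_shift_mat:
  fixes x\<^sub>1 :: "'a::field vec"
  assumes "x\<^sub>1 \<in> carrier_vec d" "x\<^sub>2 \<in> carrier_vec (sum_list ds)"
  shows "(x\<^sub>1 @\<^sub>v x\<^sub>2) \<^sub>v* shift_mat (d # ds) = (x\<^sub>1 \<^sub>v* shift_block d) @\<^sub>v (x\<^sub>2 \<^sub>v* shift_mat ds)"
  using append_vec_times_diag[of "shift_block d" d d "shift_mat ds" "sum_list ds" "sum_list ds" x\<^sub>1 x\<^sub>2]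
    shift_mat_carrier[where 'a = 'a, of ds] assms
  by (simp add: Let_def)

lemma append_vec_times_input_mat:
  fixes u\<^sub>1 :: "'a::field vec"
  assumes "u\<^sub>1 \<in> carrier_vec 1" "u\<^sub>2 \<in> carrier_vec (length ds)"
  shows "(u\<^sub>1 @\<^sub>v u\<^sub>2) \<^sub>v* input_mat (d # ds) = (u\<^sub>1 \<^sub>v* input_block d) @\<^sub>v (u\<^sub>2 \<^sub>v* input_mat ds)"
  using append_vec_times_diag[of "input_block d" 1 d "input_mat ds" "length ds" "sum_list ds" u\<^sub>1 u\<^sub>2]
    input_mat_carrier[where 'a = 'a, of ds] assms
  by (simp add: Let_def)

text \<open>The first cell of a nonempty register stores its current input symbol, so nothing enters
  unseen.\<close>

lemma input_zero_if_times_input_mat_zero: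
  fixes u :: "'a::field vec"
  assumes "u \<in> carrier_vec (length ds)" "u \<^sub>v* input_mat ds = 0\<^sub>v (sum_list ds)"
    and "i < length ds" "ds ! i > 0"
  shows "u $ i = 0"
  using assms
proof (induction ds arbitrary: u i)
  case (Cons d ds)
  define u\<^sub>1 u\<^sub>2 where "u\<^sub>1 = vec_first u 1" and "u\<^sub>2 = vec_last u (length ds)"
  have u12: "u\<^sub>1 \<in> carrier_vec 1" "u\<^sub>2 \<in> carrier_vec (length ds)" by (simp_all add: u\<^sub>1_def u\<^sub>2_def)
  have u: "u = u\<^sub>1 @\<^sub>v u\<^sub>2"
    using Cons.prems(1) by (simp add: u\<^sub>1_def u\<^sub>2_def)
  have "(u\<^sub>1 \<^sub>v* input_block d) @\<^sub>v (u\<^sub>2 \<^sub>v* input_mat ds) = 0\<^sub>v d @\<^sub>v 0\<^sub>v (sum_list ds)"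
    (is "?l @\<^sub>v ?r = _")
  proof -
    have "?l @\<^sub>v ?r = u \<^sub>v* input_mat (d # ds)"
      unfolding u by (rule append_vec_times_input_mat[OF u12, symmetric])
    also have "\<dots> = 0\<^sub>v (sum_list (d # ds))" by (rule Cons.prems(2))
    also have "\<dots> = 0\<^sub>v d @\<^sub>v 0\<^sub>v (sum_list ds)" by (auto intro!: eq_vecI)
    finally show ?thesis .
  qed
  moreover have "?l \<in> carrier_vec d" by (intro vec_times_mat_carrier[of _ 1]) simp
  ultimately have z: "?l = 0\<^sub>v d" "?r = 0\<^sub>v (sum_list ds)"
    using append_vec_eq[of ?l d "0\<^sub>v d"] by auto
  show ?case
  proof (cases i)
    case 0
    have "d > 0" using Cons.prems(4) 0 by simp
    then have "(u\<^sub>1 \<^sub>v* input_block d) $ 0 = u\<^sub>1 $ 0"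
      using u12(1) by (subst vec_times_mat_index) auto
    then show ?thesis using z(1) \<open>d > 0\<close> u u12 0 by simp
  next
    case (Suc i')
    then have "u\<^sub>2 $ i' = 0" using Cons.IH[OF u12(2) z(2), of i'] Cons.prems by simp
    then show ?thesis using Suc u u12 Cons.prems(3) by simp
  qed
qed simp

text \<open>Walks have exactly \<open>r\<close> steps, but the zero input allows waiting at state 0,
  so shorter walks are covered.\<close>

primrec reachable_states :: "nat list \<Rightarrow> nat \<Rightarrow> 'a::field vec set"
  where
    "reachable_states ds 0 = {0\<^sub>v (sum_list ds)}"
  | "reachable_states ds (Suc r) =
      {x \<^sub>v* shift_mat ds + u \<^sub>v* input_mat ds | x u. x \<in> reachable_states ds r \<and> u \<in> carrier_vec (length ds)}"

lemma reachable_states_carrier: "reachable_states ds r \<subseteq> carrier_vec (sum_list ds)"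
proof (cases r)
  case (Suc r')
  then show ?thesis using shift_mat_carrier input_mat_carrier
    by (auto intro!: add_carrier_vec vec_times_mat_carrier)
qed simp

lemma vec_carrier_add_split:
  assumes "v \<in> carrier_vec (m + n)"
  obtains v\<^sub>1 v\<^sub>2 where "v\<^sub>1 \<in> carrier_vec m" "v\<^sub>2 \<in> carrier_vec n" "v = v\<^sub>1 @\<^sub>v v\<^sub>2"
proof
  show "v = vec_first v m @\<^sub>v vec_last v n" using assms by simp
qed simp_all

section \<open>Decomposition of the reachable set into single registers\<close>

text \<open>The choice of \<open>UNIV\<close> or \<open>{0}\<close> for each coordinate has the
  shape counted by \<open>card_vec_PiE\<close>.\<close>

definition register_states :: "nat \<Rightarrow> nat \<Rightarrow> 'a::zero vec set"
  where "register_states d r = {x \<in> carrier_vec d. \<forall>i<d. x $ i \<in> (if i < r then UNIV else {0})}"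

lemma register_states_Suc:
  "(register_states d (Suc r) :: 'a::field vec set) =
    {x \<^sub>v* shift_block d + u \<^sub>v* input_block d | x u. x \<in> register_states d r \<and> u \<in> carrier_vec 1}"
    (is "_ = ?R")
proof -
  have step: "(x \<^sub>v* shift_block d + u \<^sub>v* input_block d) $ j = (if j = 0 then u $ 0 else x $ (j - 1))"
    if "x \<in> carrier_vec d" "u \<in> carrier_vec 1" "j < d" for x u :: "'a vec" and j
  proof -
    have "(x \<^sub>v* shift_block d) $ j = (\<Sum>i<d. x $ i * (if j = Suc i then 1 else 0))"
      using that by (subst vec_times_mat_index) auto
    also have "\<dots> = (\<Sum>i<d. if i = j - 1 \<and> j > 0 then x $ i else 0)"
      by (intro sum.cong) auto
    also have "\<dots> = (if j = 0 then 0 else x $ (j - 1))"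
      using that by (cases "j = 0") auto
    finally have "(x \<^sub>v* shift_block d) $ j = (if j = 0 then 0 else x $ (j - 1))" .
    moreover have "(u \<^sub>v* input_block d) $ j = (if j = 0 then u $ 0 else 0)"
      using that by (subst vec_times_mat_index) auto
    ultimately show ?thesis using that by simp
  qed
  show ?thesis
  proof
    show "?R \<subseteq> register_states d (Suc r)"
    proof
      fix y assume "y \<in> ?R"
      then obtain x u where xu: "x \<in> register_states d r" "u \<in> carrier_vec 1"
        and y: "y = x \<^sub>v* shift_block d + u \<^sub>v* input_block d" by blast
      have x: "x \<in> carrier_vec d" using xu(1) by (simp add: register_states_def)
      have "y $ j = 0" if "j < d" "\<not> j < Suc r" for j
      proof -
        have "j - 1 < d" "\<not> j - 1 < r" using that by auto
        then have "x $ (j - 1) = 0" using xu(1) unfolding register_states_def by fastforce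
        then show ?thesis unfolding y step[OF x xu(2) that(1)] using that(2) by simp
      qed
      moreover have "y \<in> carrier_vec d" unfolding y by (rule carrier_vecI) simp
      ultimately show "y \<in> register_states d (Suc r)" by (auto simp: register_states_def)
    qed
    show "register_states d (Suc r) \<subseteq> ?R"
    proof
      fix y :: "'a vec" assume y: "y \<in> register_states d (Suc r)"
      \<comment> \<open>A predecessor of \<open>y\<close> is obtained by shifting back, with the
        first cell of \<open>y\<close> as the input. The last cell of \<open>x\<close> is lost in
        the shift; the default 0 keeps \<open>x\<close> among the admissible states.\<close>
      define x where "x = vec d (\<lambda>i. if Suc i < d then y $ Suc i else 0)"
      define u where "u = vec 1 (\<lambda>_. y $ 0)"
      have "x \<in> register_states d r" using y by (auto simp: register_states_def x_def)
      moreover have u: "u \<in> carrier_vec 1" by (simp add: u_def)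
      moreover have "y = x \<^sub>v* shift_block d + u \<^sub>v* input_block d"
      proof (rule eq_vecI)
        fix j assume "j < dim_vec (x \<^sub>v* shift_block d + u \<^sub>v* input_block d)"
        then have j: "j < d" by simp
        have "x \<in> carrier_vec d" by (simp add: x_def)
        from step[OF this u j] show "y $ j = (x \<^sub>v* shift_block d + u \<^sub>v* input_block d) $ j"
          using j by (cases j) (auto simp: x_def u_def)
      qed (use y in \<open>simp add: register_states_def\<close>)
      ultimately show "y \<in> ?R" by blast
    qed
  qed
qed

text \<open>Each register has its own input symbol and all blocks are diagonal, so the registers run
  independently and the reachable set is a product.\<close>

lemma reachable_states_Cons:
  "(reachable_states (d # ds) r :: 'a::field vec set) =
    (\<lambda>(x, y). x @\<^sub>v y) ` (register_states d r \<times> reachable_states ds r)"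
proof (induction r)
  case 0
  have "register_states d 0 = {0\<^sub>v d :: 'a vec}"
    by (auto simp: register_states_def intro!: eq_vecI)
  moreover have "0\<^sub>v (d + sum_list ds) = 0\<^sub>v d @\<^sub>v (0\<^sub>v (sum_list ds) :: 'a vec)"
    by (auto intro!: eq_vecI)
  ultimately show ?case by simp
next
  case (Suc r)
  have step: "(x\<^sub>1 @\<^sub>v x\<^sub>2) \<^sub>v* shift_mat (d # ds) + (u\<^sub>1 @\<^sub>v u\<^sub>2) \<^sub>v* input_mat (d # ds) =
      (x\<^sub>1 \<^sub>v* shift_block d + u\<^sub>1 \<^sub>v* input_block d) @\<^sub>v (x\<^sub>2 \<^sub>v* shift_mat ds + u\<^sub>2 \<^sub>v* input_mat ds)"
    if "x\<^sub>1 \<in> register_states d r" "x\<^sub>2 \<in> reachable_states ds r"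
      "u\<^sub>1 \<in> carrier_vec 1" "u\<^sub>2 \<in> carrier_vec (length ds)" for x\<^sub>1 x\<^sub>2 u\<^sub>1 u\<^sub>2 :: "'a vec"
  proof -
    have x: "x\<^sub>1 \<in> carrier_vec d" "x\<^sub>2 \<in> carrier_vec (sum_list ds)"
      using that reachable_states_carrier by (auto simp: register_states_def)
    show ?thesis
      unfolding append_vec_times_shift_mat[OF x] append_vec_times_input_mat[OF that(3,4)]
      using x that shift_mat_carrier input_mat_carrier
      by (intro append_vec_add[of _ d _ _ "sum_list ds"] vec_times_mat_carrier) auto
  qed
  show ?case
  proof
    show "(reachable_states (d # ds) (Suc r) :: 'a vec set) \<subseteq>
        (\<lambda>(x, y). x @\<^sub>v y) ` (register_states d (Suc r) \<times> reachable_states ds (Suc r))"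
    proof
      fix z :: "'a vec" assume "z \<in> reachable_states (d # ds) (Suc r)"
      then obtain x u where x: "x \<in> reachable_states (d # ds) r" and u: "u \<in> carrier_vec (1 + length ds)"
        and z: "z = x \<^sub>v* shift_mat (d # ds) + u \<^sub>v* input_mat (d # ds)"
        by auto
      obtain x\<^sub>1 x\<^sub>2 where x12: "x\<^sub>1 \<in> register_states d r" "x\<^sub>2 \<in> reachable_states ds r" "x = x\<^sub>1 @\<^sub>v x\<^sub>2"
        using x unfolding Suc by auto
      obtain u\<^sub>1 u\<^sub>2 where u12: "u\<^sub>1 \<in> carrier_vec 1" "u\<^sub>2 \<in> carrier_vec (length ds)" "u = u\<^sub>1 @\<^sub>v u\<^sub>2"
        by (rule vec_carrier_add_split[OF u])
      have "z = (x\<^sub>1 \<^sub>v* shift_block d + u\<^sub>1 \<^sub>v* input_block d) @\<^sub>v (x\<^sub>2 \<^sub>v* shift_mat ds + u\<^sub>2 \<^sub>v* input_mat ds)"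
        unfolding z x12(3) u12(3) by (rule step[OF x12(1,2) u12(1,2)])
      moreover have "x\<^sub>1 \<^sub>v* shift_block d + u\<^sub>1 \<^sub>v* input_block d \<in> register_states d (Suc r)"
        unfolding register_states_Suc using x12 u12 by blast
      moreover have "x\<^sub>2 \<^sub>v* shift_mat ds + u\<^sub>2 \<^sub>v* input_mat ds \<in> reachable_states ds (Suc r)"
        using x12 u12 by auto
      ultimately show "z \<in> (\<lambda>(x, y). x @\<^sub>v y) ` (register_states d (Suc r) \<times> reachable_states ds (Suc r))"
        by blast
    qed
    show "(\<lambda>(x, y). x @\<^sub>v y) ` (register_states d (Suc r) \<times> reachable_states ds (Suc r)) \<subseteq>
        (reachable_states (d # ds) (Suc r) :: 'a vec set)"
    proof (rule image_subsetI, clarify)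
      fix y\<^sub>1 y\<^sub>2 :: "'a vec"
      assume "y\<^sub>1 \<in> register_states d (Suc r)" "y\<^sub>2 \<in> reachable_states ds (Suc r)"
      then obtain x\<^sub>1 u\<^sub>1 x\<^sub>2 u\<^sub>2 where x: "x\<^sub>1 \<in> register_states d r" "x\<^sub>2 \<in> reachable_states ds r"
        and u: "u\<^sub>1 \<in> carrier_vec 1" "u\<^sub>2 \<in> carrier_vec (length ds)"
        and y: "y\<^sub>1 = x\<^sub>1 \<^sub>v* shift_block d + u\<^sub>1 \<^sub>v* input_block d"
          "y\<^sub>2 = x\<^sub>2 \<^sub>v* shift_mat ds + u\<^sub>2 \<^sub>v* input_mat ds"
        unfolding register_states_Suc reachable_states.simps(2) by blast
      have "x\<^sub>1 @\<^sub>v x\<^sub>2 \<in> reachable_states (d # ds) r"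
        unfolding Suc using x by force
      moreover have "u\<^sub>1 @\<^sub>v u\<^sub>2 \<in> carrier_vec (length (d # ds))"
        using append_carrier_vec[OF u] by simp
      ultimately show "y\<^sub>1 @\<^sub>v y\<^sub>2 \<in> reachable_states (d # ds) (Suc r)"
        unfolding y step[OF x u, symmetric] reachable_states.simps(2) by blast
    qed
  qed
qed

lemma card_register_states:
  "card (register_states d r :: 'a::{field,finite} vec set) = CARD('a) ^ min d r"
proof -
  have "(\<Prod>i<d. card (if i < r then UNIV else {0 :: 'a})) = (\<Prod>i<d. if i < r then CARD('a) else 1)"
    by (intro prod.cong) auto
  also have "\<dots> = (\<Prod>i\<in>{..<d} \<inter> {i. i < r}. CARD('a))"
    by (subst prod.If_cases) auto
  also have "{..<d} \<inter> {i. i < r} = {..<min d r}" by auto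
  finally show ?thesis unfolding register_states_def card_vec_PiE by simp
qed

lemma card_reachable_states:
  "card (reachable_states ds r :: 'a::{field,finite} vec set) = CARD('a) ^ (\<Sum>d\<leftarrow>ds. min d r)"
proof (induction ds)
  case Nil
  have "reachable_states [] r = {0\<^sub>v 0 :: 'a vec}"
  proof (induction r)
    case (Suc r)
    have "x \<^sub>v* shift_mat [] + u \<^sub>v* input_mat [] = 0\<^sub>v 0" for x u :: "'a vec" by auto
    then show ?case unfolding reachable_states.simps Suc by (auto intro: exI[of _ "0\<^sub>v 0"])
  qed simp
  then show ?case by simp
next
  case (Cons d ds)
  have "inj_on (\<lambda>(x, y). x @\<^sub>v y) (register_states d r \<times> (reachable_states ds r :: 'a vec set))"
    by (rule inj_onI) (auto simp: register_states_def append_vec_eq[of _ d])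
  then show ?case
    unfolding reachable_states_Cons
    by (simp add: card_image card_cartesian_product Cons card_register_states power_add)
qed

section \<open>Invariants of the generalized adjacency matrix\<close>

text \<open>
  The loop at state 0 belongs to the state diagram, but may be invisible in the adjacency matrix
  because of the convention \<open>\<lambda>\<^sub>0\<^sub>0 = 0\<close> for weight 0; it is added back by hand.
\<close>

primrec walk_ends :: "rat poly mat \<Rightarrow> nat \<Rightarrow> nat set"
  where
    "walk_ends \<Lambda> 0 = {0}"
  | "walk_ends \<Lambda> (Suc r) =
      {j. j < dim_row \<Lambda> \<and> (\<exists>i\<in>walk_ends \<Lambda> r. i = 0 \<and> j = 0 \<or> \<Lambda> $$ (i, j) \<noteq> 0)}"

section \<open>Invariance under renumbering of the nonzero states\<close>

lemma permutation_class_entries: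
  assumes "M \<in> permutation_class \<Lambda>"
  obtains \<pi> where "dim_row M = dim_row \<Lambda>" "\<pi> permutes {..<dim_row \<Lambda>}" "\<pi> 0 = 0"
    "\<forall>i<dim_row \<Lambda>. \<forall>j<dim_row \<Lambda>. M $$ (i, j) = \<Lambda> $$ (\<pi> i, \<pi> j)"
proof -
  define s where "s = dim_row \<Lambda>"
  obtain P Q where P: "P \<in> pointed_permutation_mats s"
    and sim: "similar_mat_wit M \<Lambda> (map_mat (\<lambda>c. [:c:]) P) Q"
    using assms unfolding permutation_class_def s_def by auto
  obtain \<pi> where \<pi>: "\<pi> permutes {..<s}" and P_eq: "P = mat s s (\<lambda>(i, j). if j = \<pi> i then 1 else 0)"
    and P00: "P $$ (0, 0) = 1"
    using P unfolding pointed_permutation_mats_def by auto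
  define R where "R = map_mat (\<lambda>c :: rat. [:c:]) P"
  have R: "R \<in> carrier_mat s s" and R_index: "\<And>i j. i < s \<Longrightarrow> j < s \<Longrightarrow> R $$ (i, j) = (if j = \<pi> i then 1 else 0)"
    unfolding R_def P_eq by auto
  have lt: "\<pi> i < s" if "i < s" for i using permutes_in_image[OF \<pi>, of i] that by simp
  define m where "m = dim_row M"
  note simD = similar_mat_witD[OF m_def sim, folded R_def]
  have ms: "m = s" using simD(6) R by auto
  have M: "M \<in> carrier_mat s s" and \<Lambda>: "\<Lambda> \<in> carrier_mat s s" and Q: "Q \<in> carrier_mat s s"
    using simD ms by auto
  \<comment> \<open>Multiplying by \<open>R\<close> on the right removes the inverse matrix
    \<open>Q\<close>; column \<open>\<pi> j\<close> of both sides can then be read off.\<close>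
  have "M * R = R * \<Lambda> * (Q * R)"
    using simD(3) R \<Lambda> Q assoc_mult_mat[of "R * \<Lambda>" s s Q s R s] by simp
  then have MR: "M * R = R * \<Lambda>" using simD(2) ms R \<Lambda> by simp
  have entry: "M $$ (i, j) = \<Lambda> $$ (\<pi> i, \<pi> j)" if ij: "i < s" "j < s" for i j
  proof -
    have "(M * R) $$ (i, \<pi> j) = (\<Sum>l<s. M $$ (i, l) * R $$ (l, \<pi> j))"
      using M R ij lt by (auto simp: scalar_prod_def atLeast0LessThan intro!: sum.cong)
    also have "\<dots> = (\<Sum>l<s. if l = j then M $$ (i, l) else 0)"
      using ij lt inj_eq[OF permutes_inj[OF \<pi>]] by (intro sum.cong) (auto simp: R_index)
    also have "\<dots> = M $$ (i, j)" using ij by simp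
    finally have l: "(M * R) $$ (i, \<pi> j) = M $$ (i, j)" .
    have "(R * \<Lambda>) $$ (i, \<pi> j) = (\<Sum>l<s. R $$ (i, l) * \<Lambda> $$ (l, \<pi> j))"
      using \<Lambda> R ij lt by (auto simp: scalar_prod_def atLeast0LessThan intro!: sum.cong)
    also have "\<dots> = (\<Sum>l<s. if l = \<pi> i then \<Lambda> $$ (l, \<pi> j) else 0)"
      using ij by (intro sum.cong) (auto simp: R_index)
    also have "\<dots> = \<Lambda> $$ (\<pi> i, \<pi> j)" using ij lt by simp
    finally show ?thesis using l MR by simp
  qed
  have "\<pi> 0 = 0"
  \<comment> \<open>For size 0 the entry (0, 0) carries no information, but a permutation of the
    empty set fixes every number.\<close>
  proof (cases "s = 0")
    case True
    then show ?thesis using \<pi> by (simp add: permutes_def)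
  next
    case False
    then show ?thesis using P00 unfolding P_eq by (simp split: if_splits)
  qed
  then show ?thesis using that \<pi> entry M unfolding s_def by auto
qed

text \<open>The renumbering carries nonzero entries to nonzero entries and fixes 0, so it also
  respects the loop added by hand.\<close>

lemma walk_ends_permutation_class:
  assumes "M \<in> permutation_class \<Lambda>"
  shows "card (walk_ends M r) = card (walk_ends \<Lambda> r)"
proof -
  obtain \<pi> where dim: "dim_row M = dim_row \<Lambda>" and \<pi>: "\<pi> permutes {..<dim_row \<Lambda>}" "\<pi> 0 = 0"
    and entry: "\<forall>i<dim_row \<Lambda>. \<forall>j<dim_row \<Lambda>. M $$ (i, j) = \<Lambda> $$ (\<pi> i, \<pi> j)"
    by (rule permutation_class_entries[OF assms])
  have inj: "inj \<pi>" by (rule permutes_inj[OF \<pi>(1)])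
  have zero: "\<pi> i = 0 \<longleftrightarrow> i = 0" for i using injD[OF inj, of i 0] \<pi>(2) by auto
  have lt: "\<pi> i < dim_row \<Lambda> \<longleftrightarrow> i < dim_row \<Lambda>" for i
    using permutes_in_image[OF \<pi>(1), of i] by simp
  have "\<pi> ` walk_ends M r = walk_ends \<Lambda> r"
  \<comment> \<open>Without states \<open>walk_ends\<close> still starts as \<open>{0}\<close>,
    outside the index range.\<close>
  proof (cases "dim_row \<Lambda> = 0")
    case True
    then show ?thesis using dim \<pi>(2) by (cases r) auto
  next
    case False
    have bound: "walk_ends M r \<subseteq> {..<dim_row \<Lambda>}" for r using False dim by (cases r) auto
    show ?thesis
    proof (induction r)
      case (Suc r)
      have iff: "\<pi> j \<in> walk_ends \<Lambda> (Suc r) \<longleftrightarrow> j \<in> walk_ends M (Suc r)" for j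
      proof (cases "j < dim_row \<Lambda>")
        case True
        have "(\<exists>i\<in>walk_ends \<Lambda> r. i = 0 \<and> \<pi> j = 0 \<or> \<Lambda> $$ (i, \<pi> j) \<noteq> 0) \<longleftrightarrow>
            (\<exists>i\<in>walk_ends M r. \<pi> i = 0 \<and> \<pi> j = 0 \<or> \<Lambda> $$ (\<pi> i, \<pi> j) \<noteq> 0)"
          unfolding Suc.IH[symmetric] by blast
        also have "\<dots> \<longleftrightarrow> (\<exists>i\<in>walk_ends M r. i = 0 \<and> j = 0 \<or> M $$ (i, j) \<noteq> 0)"
          using bound[of r] entry True zero by (intro bex_cong) auto
        finally show ?thesis using True dim lt by simp
      qed (use dim lt in simp)
      have "j \<in> \<pi> ` walk_ends M (Suc r)" if "j \<in> walk_ends \<Lambda> (Suc r)" for j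
      proof -
        obtain i where "j = \<pi> i" using permutes_surj[OF \<pi>(1)] by (metis surjD)
        then show ?thesis using that iff[of i] by blast
      qed
      then show ?case using iff by blast
    qed (simp add: \<pi>(2))
  qed
  then show ?thesis using card_image[OF inj_on_subset[OF inj subset_UNIV], of "walk_ends M r"] by simp
qed

lemma row_sum_permutation_class:
  assumes "M \<in> permutation_class \<Lambda>"
  shows "(\<Sum>j<dim_row M. poly (M $$ (0, j)) 1) = (\<Sum>j<dim_row \<Lambda>. poly (\<Lambda> $$ (0, j)) 1)"
proof -
  obtain \<pi> where dim: "dim_row M = dim_row \<Lambda>" and \<pi>: "\<pi> permutes {..<dim_row \<Lambda>}" "\<pi> 0 = 0"
    and entry: "\<forall>i<dim_row \<Lambda>. \<forall>j<dim_row \<Lambda>. M $$ (i, j) = \<Lambda> $$ (\<pi> i, \<pi> j)"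
    by (rule permutation_class_entries[OF assms])
  have "(\<Sum>j<dim_row \<Lambda>. poly (\<Lambda> $$ (0, j)) 1) = (\<Sum>j<dim_row \<Lambda>. poly (\<Lambda> $$ (0, \<pi> j)) 1)"
    by (rule sum.permute[OF \<pi>(1), unfolded o_def])
  also have "\<dots> = (\<Sum>j<dim_row \<Lambda>. poly (M $$ (0, j)) 1)"
    using entry \<pi>(2) by (intro sum.cong) (auto dest: spec[of _ 0])
  finally show ?thesis using dim by simp
qed

text \<open>Turns equality of two classes into membership of one matrix in the class of the
  other.\<close>

lemma self_in_permutation_class:
  assumes "\<Lambda> \<in> carrier_mat s s" "s > 0"
  shows "\<Lambda> \<in> permutation_class \<Lambda>"
proof -
  have "(1\<^sub>m s :: rat mat) \<in> pointed_permutation_mats s"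
    unfolding pointed_permutation_mats_def
    using assms(2) by (auto intro!: exI[of _ id] permutes_id eq_matI)
  moreover have "map_mat (\<lambda>c :: rat. [:c:]) (1\<^sub>m s) = 1\<^sub>m s" by (auto intro!: eq_matI)
  ultimately show ?thesis
    unfolding permutation_class_def using assms similar_mat_wit_refl[OF assms(1)] by force
qed

section \<open>Edges and input counts of the state diagram\<close>

lemma ccf_A_eq: "ccf_A G = shift_mat (row_degrees G)"
  by (simp add: ccf_A_def)

lemma ccf_B_eq: "ccf_B G = input_mat (row_degrees G)"
  by (simp add: ccf_B_def)

lemma ccf_C_carrier: "ccf_C G \<in> carrier_mat (state_dim G) (dim_col G)"
proof -
  have "foldr (@\<^sub>r) (map (ccf_C_block G) is) (0\<^sub>m 0 (dim_col G))
      \<in> carrier_mat (\<Sum>i\<leftarrow>is. row_degree G i) (dim_col G)" for "is"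
    by (induction "is") (auto simp: ccf_C_block_def intro!: carrier_append_rows)
  then show ?thesis by (simp add: ccf_C_def row_degrees_def)
qed

lemma hamming_weight_le: "hamming_weight v \<le> dim_vec v"
proof -
  have "hamming_weight v \<le> card {..<dim_vec v}"
    unfolding hamming_weight_def by (intro card_mono) auto
  then show ?thesis by simp
qed

lemma hamming_weight_eq_0_iff: "hamming_weight v = 0 \<longleftrightarrow> v = 0\<^sub>v (dim_vec v)"
proof -
  have "hamming_weight v = 0 \<longleftrightarrow> (\<forall>i<dim_vec v. v $ i = 0)"
    by (auto simp: hamming_weight_def)
  then show ?thesis by (metis eq_vecI index_zero_vec)
qed

lemma adjacency_matrix_carrier:
  fixes G :: "'a::{field,finite} poly mat"
  shows "adjacency_matrix G X \<in> carrier_mat (CARD('a) ^ state_dim G) (CARD('a) ^ state_dim G)"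
  by (simp add: adjacency_matrix_def)

text \<open>The coefficients are cardinalities, so nothing cancels, and every weight is at most
  \<open>dim_col G\<close>, so no input is missed. The loop at 0 comes from the zero input.\<close>

lemma adjacency_matrix_edge:
  fixes G :: "'a::{field,finite} poly mat"
  assumes X: "state_ordering G X"
    and ij: "i < CARD('a) ^ state_dim G" "j < CARD('a) ^ state_dim G"
  shows "i = 0 \<and> j = 0 \<or> adjacency_matrix G X $$ (i, j) \<noteq> 0 \<longleftrightarrow>
    (\<exists>u\<in>carrier_vec (dim_row G). X j = X i \<^sub>v* ccf_A G + u \<^sub>v* ccf_B G)"
proof (cases "i = 0 \<and> j = 0")
  case True
  have "X 0 = X 0 \<^sub>v* ccf_A G + 0\<^sub>v (dim_row G) \<^sub>v* ccf_B G"
    using X shift_mat_carrier[where 'a = 'a, of "row_degrees G"]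
      input_mat_carrier[where 'a = 'a, of "row_degrees G"]
    by (simp add: state_ordering_def ccf_A_eq ccf_B_eq row_degrees_def)
  then show ?thesis using True by (auto intro: bexI[of _ "0\<^sub>v (dim_row G)"])
next
  case False
  define U where "U \<alpha> = {u \<in> carrier_vec (dim_row G). X j = X i \<^sub>v* ccf_A G + u \<^sub>v* ccf_B G \<and>
      hamming_weight (X i \<^sub>v* ccf_C G + u \<^sub>v* ccf_D G) = \<alpha>}" for \<alpha>
  have t: "transition_count G X i j \<alpha> = card (U \<alpha>)" for \<alpha>
    using False by (auto simp: transition_count_def U_def)
  have fin: "finite (U \<alpha>)" for \<alpha> unfolding U_def by (rule finite_subset[of _ "carrier_vec (dim_row G)"]) auto
  have c: "coeff (adjacency_matrix G X $$ (i, j)) \<alpha> =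
      (if \<alpha> \<le> dim_col G then of_nat (card (U \<alpha>)) else 0)" for \<alpha>
    using ij by (simp add: adjacency_matrix_def coeff_sum t)
  have "hamming_weight (X i \<^sub>v* ccf_C G + u \<^sub>v* ccf_D G) \<le> dim_col G" for u
    using hamming_weight_le[of "X i \<^sub>v* ccf_C G + u \<^sub>v* ccf_D G"] by (simp add: ccf_D_def)
  then have ex: "(\<exists>\<alpha>\<le>dim_col G. U \<alpha> \<noteq> {}) \<longleftrightarrow>
      (\<exists>u\<in>carrier_vec (dim_row G). X j = X i \<^sub>v* ccf_A G + u \<^sub>v* ccf_B G)"
    unfolding U_def by blast
  have "adjacency_matrix G X $$ (i, j) \<noteq> 0 \<longleftrightarrow> (\<exists>\<alpha>\<le>dim_col G. U \<alpha> \<noteq> {})"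
    using fin by (auto simp: poly_eq_iff c)
  then show ?thesis using False ex by argo
qed

lemma card_walk_ends:
  fixes G :: "'a::{field,finite} poly mat"
  assumes X: "state_ordering G X"
  shows "card (walk_ends (adjacency_matrix G X) r) = CARD('a) ^ (\<Sum>d\<leftarrow>row_degrees G. min d r)"
proof -
  define s where "s = CARD('a) ^ state_dim G"
  have bij: "bij_betw X {..<s} (carrier_vec (state_dim G))" and X0: "X 0 = 0\<^sub>v (state_dim G)"
    using X by (auto simp: state_ordering_def s_def)
  have dim: "dim_row (adjacency_matrix G X) = s" by (simp add: adjacency_matrix_def s_def)
  have bound: "walk_ends (adjacency_matrix G X) r \<subseteq> {..<s}" for r
    by (cases r) (auto simp: dim s_def)
  have "X ` walk_ends (adjacency_matrix G X) r = reachable_states (row_degrees G) r"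
  proof (induction r)
    case (Suc r)
    have edge: "(\<exists>i\<in>walk_ends (adjacency_matrix G X) r. i = 0 \<and> j = 0 \<or> adjacency_matrix G X $$ (i, j) \<noteq> 0)
        \<longleftrightarrow> X j \<in> reachable_states (row_degrees G) (Suc r)" if j: "j < s" for j
    proof -
      have "(\<exists>i\<in>walk_ends (adjacency_matrix G X) r. i = 0 \<and> j = 0 \<or> adjacency_matrix G X $$ (i, j) \<noteq> 0)
          \<longleftrightarrow> (\<exists>i\<in>walk_ends (adjacency_matrix G X) r. \<exists>u\<in>carrier_vec (dim_row G).
              X j = X i \<^sub>v* ccf_A G + u \<^sub>v* ccf_B G)"
        using adjacency_matrix_edge[OF X _ j[unfolded s_def]] bound[of r]
        by (intro bex_cong refl) (auto simp: s_def)
      also have "\<dots> \<longleftrightarrow> X j \<in> reachable_states (row_degrees G) (Suc r)"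
        unfolding reachable_states.simps(2) Suc.IH[symmetric]
        by (auto simp: ccf_A_eq ccf_B_eq row_degrees_def)
      finally show ?thesis .
    qed
    show ?case
    proof
      show "X ` walk_ends (adjacency_matrix G X) (Suc r) \<subseteq> reachable_states (row_degrees G) (Suc r)"
        using edge dim by auto
      show "(reachable_states (row_degrees G) (Suc r) :: 'a vec set) \<subseteq> X ` walk_ends (adjacency_matrix G X) (Suc r)"
      proof
        fix y :: "'a vec" assume y: "y \<in> reachable_states (row_degrees G) (Suc r)"
        then have "y \<in> carrier_vec (state_dim G)" using reachable_states_carrier by blast
        then obtain j where "j < s" "y = X j" using bij by (auto simp: bij_betw_def)
        then show "y \<in> X ` walk_ends (adjacency_matrix G X) (Suc r)"
          using edge[of j] y dim by auto
      qed
    qed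
  qed (simp add: X0)
  moreover have "inj_on X (walk_ends (adjacency_matrix G X) r)"
    using bij bound by (auto simp: bij_betw_def intro: inj_on_subset)
  ultimately show ?thesis using card_image card_reachable_states by metis
qed

text \<open>The next state being 0 kills the inputs of rows of positive degree. The remaining rows
  are constant and agree with those of \<open>ccf_D G\<close>, so \<open>u\<close> annihilates
  \<open>G\<close> itself, which has a right inverse.\<close>

lemma input_with_zero_output_and_state:
  fixes G :: "'a::{field,finite} poly mat"
  assumes gen: "generator_matrix n \<C> G" and u: "u \<in> carrier_vec (dim_row G)"
    and B: "u \<^sub>v* ccf_B G = 0\<^sub>v (state_dim G)" and D: "u \<^sub>v* ccf_D G = 0\<^sub>v n"
  shows "u = 0\<^sub>v (dim_row G)"
proof -
  define k where "k = dim_row G"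
  obtain H where G: "G \<in> carrier_mat k n" and H: "H \<in> carrier_mat n k" "G * H = 1\<^sub>m k"
    by (rule generator_matrixE[OF gen, folded k_def])
  have uk: "u \<in> carrier_vec k" using u by (simp add: k_def)
  have len: "length (row_degrees G) = k" by (simp add: row_degrees_def k_def)
  have u0: "u $ i = 0" if "i < k" "row_degree G i > 0" for i
    using input_zero_if_times_input_mat_zero[of u "row_degrees G" i] uk B that len
    by (simp add: ccf_B_eq) (simp add: row_degrees_def k_def)
  have "map_vec (\<lambda>c. [:c:]) u \<^sub>v* G = 0\<^sub>v n"
  proof (rule eq_vecI)
    fix j assume "j < dim_vec (0\<^sub>v n :: 'a poly vec)"
    then have j: "j < n" by simp
    have "[:u $ i:] * G $$ (i, j) = [:u $ i * ccf_D G $$ (i, j):]" if i: "i < k" for i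
    proof (cases "row_degree G i > 0")
      case False
      then have "degree (G $$ (i, j)) = 0" using degree_le_row_degree[of j G i] j G by simp
      then show ?thesis using G i j by (auto simp: ccf_D_def elim!: degree_eq_zeroE)
    qed (use u0[OF i] in simp)
    then have "(map_vec (\<lambda>c. [:c:]) u \<^sub>v* G) $ j = (\<Sum>i<k. [:u $ i * ccf_D G $$ (i, j):])"
      using G uk j by (subst vec_times_mat_index) (auto intro!: sum.cong)
    also have "\<dots> = [:(u \<^sub>v* ccf_D G) $ j:]"
      using G uk j by (subst vec_times_mat_index)
        (auto simp: ccf_D_def poly_eq_iff coeff_sum coeff_pCons split: nat.split)
    finally show "(map_vec (\<lambda>c. [:c:]) u \<^sub>v* G) $ j = 0\<^sub>v n $ j" using D j by simp
  qed (use G in auto)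
  then show ?thesis using const_vec_times_mat_eq_0[OF G H uk] by (simp add: k_def)
qed

lemma adjacency_matrix_row_0_sum:
  fixes G :: "'a::{field,finite} poly mat"
  assumes gen: "generator_matrix n \<C> G" and X: "state_ordering G X"
  shows "1 + (\<Sum>j<dim_row (adjacency_matrix G X). poly (adjacency_matrix G X $$ (0, j)) 1) =
    of_nat (CARD('a) ^ dim_row G)"
proof -
  define s where "s = CARD('a) ^ state_dim G"
  have bij: "bij_betw X {..<s} (carrier_vec (state_dim G))" and X0: "X 0 = 0\<^sub>v (state_dim G)"
    using X by (auto simp: state_ordering_def s_def)
  have s: "s > 0" by (simp add: s_def)
  have n: "dim_col G = n" using gen by (simp add: generator_matrix_def)
  have A: "ccf_A G \<in> carrier_mat (state_dim G) (state_dim G)"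
    unfolding ccf_A_eq by (rule shift_mat_carrier)
  have B: "ccf_B G \<in> carrier_mat (dim_row G) (state_dim G)"
    using input_mat_carrier[where 'a = 'a, of "row_degrees G"] by (simp add: ccf_B_eq row_degrees_def)
  have C: "ccf_C G \<in> carrier_mat (state_dim G) n" using ccf_C_carrier[of G] n by simp
  have D: "ccf_D G \<in> carrier_mat (dim_row G) n" using n by (auto simp: ccf_D_def)
  define U :: "'a vec set" where "U = carrier_vec (dim_row G)"
  define wt where "wt u = hamming_weight (u \<^sub>v* ccf_D G)" for u
  \<comment> \<open>From state 0 an input has one next state and one output weight. The fibres of
    \<open>g\<close> partition the inputs, and their sizes are the transition counts except at
    \<open>(0, 0)\<close>.\<close>
  define g where "g u = (inv_into {..<s} X (u \<^sub>v* ccf_B G), wt u)" for u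
  define c where "c p = card {u \<in> U. g u = p}" for p
  have fU: "finite U" by (simp add: U_def)
  have uB: "u \<^sub>v* ccf_B G \<in> X ` {..<s}" for u
    using vec_times_mat_carrier[OF B] bij by (simp add: bij_betw_def)
  have t: "transition_count G X 0 j \<alpha> = (if j = 0 \<and> \<alpha> = 0 then 0 else c (j, \<alpha>))" if j: "j < s" for j \<alpha>
  proof -
    have "X j = X 0 \<^sub>v* ccf_A G + u \<^sub>v* ccf_B G \<and> hamming_weight (X 0 \<^sub>v* ccf_C G + u \<^sub>v* ccf_D G) = \<alpha>
        \<longleftrightarrow> g u = (j, \<alpha>)" for u
    proof -
      have "X 0 \<^sub>v* ccf_A G + u \<^sub>v* ccf_B G = u \<^sub>v* ccf_B G"
        "X 0 \<^sub>v* ccf_C G + u \<^sub>v* ccf_D G = u \<^sub>v* ccf_D G"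
        using A B C D vec_times_mat_carrier[OF B, of u] vec_times_mat_carrier[OF D, of u]
        by (simp_all add: X0)
      moreover have "X j = u \<^sub>v* ccf_B G \<longleftrightarrow> inv_into {..<s} X (u \<^sub>v* ccf_B G) = j"
      proof
        assume "X j = u \<^sub>v* ccf_B G"
        then show "inv_into {..<s} X (u \<^sub>v* ccf_B G) = j"
          using inv_into_f_f[OF bij_betw_imp_inj_on[OF bij], of j] j by simp
      qed (use f_inv_into_f[OF uB[of u]] in auto)
      ultimately show ?thesis by (simp add: g_def wt_def)
    qed
    then show ?thesis by (simp add: transition_count_def c_def U_def)
  qed
  \<comment> \<open>The fibre suppressed by the convention contains the zero input only; this is the
    summand 1 in the claim.\<close>
  have c00: "c (0, 0) = 1"
  proof -
    have "{u \<in> U. g u = (0, 0)} = {0\<^sub>v (dim_row G)}"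
    proof
      show "{u \<in> U. g u = (0, 0)} \<subseteq> {0\<^sub>v (dim_row G)}"
      proof
        fix u assume "u \<in> {u \<in> U. g u = (0, 0)}"
        then have u: "u \<in> carrier_vec (dim_row G)" and "inv_into {..<s} X (u \<^sub>v* ccf_B G) = 0" "wt u = 0"
          by (auto simp: g_def U_def)
        then have "u \<^sub>v* ccf_B G = 0\<^sub>v (state_dim G)" "u \<^sub>v* ccf_D G = 0\<^sub>v n"
          using f_inv_into_f[OF uB[of u]] X0 D by (auto simp: wt_def hamming_weight_eq_0_iff)
        then show "u \<in> {0\<^sub>v (dim_row G)}" using input_with_zero_output_and_state[OF gen u] by simp
      qed
      have "inv_into {..<s} X (X 0) = 0" using bij s by (intro inv_into_f_f) (auto simp: bij_betw_def)
      then have "g (0\<^sub>v (dim_row G)) = (0, 0)"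
        using B D X0 by (simp add: g_def wt_def hamming_weight_eq_0_iff)
      then show "{0\<^sub>v (dim_row G)} \<subseteq> {u \<in> U. g u = (0, 0)}" by (simp add: U_def)
    qed
    then show ?thesis by (simp add: c_def)
  qed
  have "g ` U \<subseteq> {..<s} \<times> {..n}"
  proof (rule image_subsetI)
    fix u
    have "wt u \<le> n" using hamming_weight_le[of "u \<^sub>v* ccf_D G"] D by (simp add: wt_def)
    then show "g u \<in> {..<s} \<times> {..n}" using inv_into_into[OF uB[of u]] by (simp add: g_def)
  qed
  then have "card U = (\<Sum>p\<in>{..<s} \<times> {..n}. c p)"
    using sum.group[OF fU _ \<open>g ` U \<subseteq> _\<close>, of "\<lambda>_. 1 :: nat"] by (simp add: c_def)
  also have "\<dots> = c (0, 0) + (\<Sum>p\<in>{..<s} \<times> {..n} - {(0, 0)}. c p)"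
    using s by (intro sum.remove) auto
  also have "(\<Sum>p\<in>{..<s} \<times> {..n} - {(0, 0)}. c p) =
      (\<Sum>p\<in>{..<s} \<times> {..n} - {(0, 0)}. transition_count G X 0 (fst p) (snd p))"
  proof (intro sum.cong refl)
    fix p assume p: "p \<in> {..<s} \<times> {..n} - {(0, 0)}"
    then show "c p = transition_count G X 0 (fst p) (snd p)"
      using t[of "fst p" "snd p"] by (cases p) (auto simp del: One_nat_def)
  qed
  \<comment> \<open>The transition count at \<open>(0, 0)\<close> is 0 by convention, so this index
    may be put back.\<close>
  also have "\<dots> = (\<Sum>p\<in>{..<s} \<times> {..n}. transition_count G X 0 (fst p) (snd p))"
    using t[OF s, of 0] by (intro sum.mono_neutral_left) auto
  also have "\<dots> = (\<Sum>j<s. \<Sum>\<alpha>\<le>n. transition_count G X 0 j \<alpha>)"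
    by (simp add: sum.cartesian_product case_prod_beta)
  finally have "CARD('a) ^ dim_row G = 1 + (\<Sum>j<s. \<Sum>\<alpha>\<le>n. transition_count G X 0 j \<alpha>)"
    by (simp add: c00 U_def card_carrier_vec)
  moreover have "poly (adjacency_matrix G X $$ (0, j)) 1 =
      of_nat (\<Sum>\<alpha>\<le>n. transition_count G X 0 j \<alpha>)" if "j < s" for j
    using that s n by (simp add: adjacency_matrix_def s_def poly_sum poly_monom atLeast0AtMost)
  moreover have "dim_row (adjacency_matrix G X) = s" by (simp add: adjacency_matrix_def s_def)
  ultimately show ?thesis by simp
qed

section \<open>Choice of representatives and conclusion\<close>

lemma ex_state_ordering:
  fixes G :: "'a::{field,finite} poly mat"
  shows "\<exists>X. state_ordering G X"
proof -
  have "card (carrier_vec (state_dim G) :: 'a vec set) = CARD('a) ^ state_dim G"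
    by (rule card_carrier_vec)
  then obtain h where h: "bij_betw h {..<CARD('a) ^ state_dim G} (carrier_vec (state_dim G) :: 'a vec set)"
    using ex_bij_betw_nat_finite[OF finite_carrier_vec[where 'a = 'a, of "state_dim G"]]
    unfolding atLeast0LessThan by metis
  have "0\<^sub>v (state_dim G) \<in> h ` {..<CARD('a) ^ state_dim G}"
    using h by (simp add: bij_betw_def)
  then obtain m where m: "m < CARD('a) ^ state_dim G" "h m = 0\<^sub>v (state_dim G)" by auto
  \<comment> \<open>Exchanging 0 with the index \<open>m\<close> of the zero vector makes the zero
    state the first one.\<close>
  have "bij_betw (transpose 0 m) {..<CARD('a) ^ state_dim G} {..<CARD('a) ^ state_dim G}"
    using m(1) by (intro permutes_imp_bij permutes_swap_id) auto
  then have "bij_betw (h \<circ> transpose 0 m) {..<CARD('a) ^ state_dim G} (carrier_vec (state_dim G))"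
    using h by (rule bij_betw_trans)
  then show ?thesis using m(2) by (auto simp: state_ordering_def)
qed

lemma generalized_adjacency_matrix_witness:
  fixes \<C> :: "'a::{field,finite} fls vec set"
  assumes "convolutional_code n k \<C>"
  obtains G X where "minimal_generator_matrix n \<C> G" "state_ordering G X"
    "generalized_adjacency_matrix n \<C> = permutation_class (adjacency_matrix G X)"
proof -
  obtain G where "minimal_generator_matrix n \<C> G"
    using ex_minimal_generator_matrix[OF assms] by blast
  moreover obtain X where "state_ordering G X" using ex_state_ordering by blast
  ultimately have "\<exists>L G X. minimal_generator_matrix n \<C> G \<and> state_ordering G X \<and>
      L = permutation_class (adjacency_matrix G X)" by blast
  from someI_ex[OF this] show ?thesis
    using that unfolding generalized_adjacency_matrix_def by blast
qed

lemma dim_row_generator_matrix: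
  fixes G :: "'a::{field,finite} poly mat"
  assumes "convolutional_code n k \<C>" "generator_matrix n \<C> G"
  shows "dim_row G = k"
proof -
  obtain G' where "G' \<in> carrier_mat k n" "generator_matrix n \<C> G'"
    using assms(1) unfolding convolutional_code_def by blast
  then show ?thesis using generator_matrices_equivalent[OF _ assms(2)] by (metis carrier_matD(1))
qed

theorem theorem5p1:
  fixes \<C> \<C>' :: "'a::{field,finite} fls vec set" and n k k' :: nat
  assumes "convolutional_code n k \<C>" and "convolutional_code n k' \<C>'"
    and "overall_constraint_length n \<C> = overall_constraint_length n \<C>'"
    and "generalized_adjacency_matrix n \<C> = generalized_adjacency_matrix n \<C>'"
  shows "k = k' \<and> forney_indices n \<C> = forney_indices n \<C>'"
proof -
  obtain G X where G: "minimal_generator_matrix n \<C> G" and X: "state_ordering G X"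
    and L: "generalized_adjacency_matrix n \<C> = permutation_class (adjacency_matrix G X)"
    by (rule generalized_adjacency_matrix_witness[OF assms(1)])
  obtain G' X' where G': "minimal_generator_matrix n \<C>' G'" and X': "state_ordering G' X'"
    and L': "generalized_adjacency_matrix n \<C>' = permutation_class (adjacency_matrix G' X')"
    by (rule generalized_adjacency_matrix_witness[OF assms(2)])
  have gen: "generator_matrix n \<C> G" and gen': "generator_matrix n \<C>' G'"
    using G G' by (auto simp: minimal_generator_matrix_def)
  have q: "CARD('a) > 1" by (rule CARD_field_gt_1)
  have "adjacency_matrix G X \<in> permutation_class (adjacency_matrix G X)"
    by (rule self_in_permutation_class[OF adjacency_matrix_carrier]) simp
  then have cls: "adjacency_matrix G X \<in> permutation_class (adjacency_matrix G' X')"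
    using assms(4) L L' by simp
  have "(of_nat (CARD('a) ^ dim_row G) :: rat) = of_nat (CARD('a) ^ dim_row G')"
    using adjacency_matrix_row_0_sum[OF gen X] adjacency_matrix_row_0_sum[OF gen' X']
      row_sum_permutation_class[OF cls] by simp
  then have dims: "dim_row G = dim_row G'" using q by (metis of_nat_eq_iff power_inject_exp)
  have "mset (row_degrees G) = mset (row_degrees G')"
  proof (rule mset_eq_if_truncated_sums_eq)
    fix r
    have "CARD('a) ^ (\<Sum>d\<leftarrow>row_degrees G. min d r) = CARD('a) ^ (\<Sum>d\<leftarrow>row_degrees G'. min d r)"
      using walk_ends_permutation_class[OF cls, of r] by (simp add: card_walk_ends[OF X] card_walk_ends[OF X'])
    then have min: "(\<Sum>d\<leftarrow>row_degrees G. min d r) = (\<Sum>d\<leftarrow>row_degrees G'. min d r)"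
      using q by (metis power_inject_exp)
    \<comment> \<open>The length of the list enters here, hence the dimensions already shown to be
      equal.\<close>
    have compl: "(\<Sum>d\<leftarrow>ds. r - d) + (\<Sum>d\<leftarrow>ds. min d r) = length ds * r" for ds :: "nat list"
      by (induction ds) auto
    show "(\<Sum>x\<leftarrow>row_degrees G. r - x) = (\<Sum>y\<leftarrow>row_degrees G'. r - y)"
      using compl[of "row_degrees G"] compl[of "row_degrees G'"] min dims by (simp add: row_degrees_def)
  qed
  then show ?thesis
    using dims dim_row_generator_matrix[OF assms(1) gen] dim_row_generator_matrix[OF assms(2) gen']
      forney_indices_eq[OF G] forney_indices_eq[OF G'] by simp
qed

end
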